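(* The following four statements hold. (1) Let $h = h_7 + R_8 \colon (\mathbf{R}^2,\mathbf{0}) \to (\mathbf{R},0)$ be a function-germ, where $h_7$ is a non-zero homogeneous harmonic polynomial of degree $7$ and $R_8$ is a function-germ with $\mathrm{ord}(R_8) \ge 8$. Then $h$ is right-equivalent, by a linear conformal diffeomorphism-germ, to $g_7 + \tilde{R}_8$ for some function-germ $\tilde{R}_8$ with $\mathrm{ord}(\tilde{R}_8) \ge 8$. (2) For any homogeneous polynomial $\rho_8$ of degree $8$ in $(x,y)$, the germ $g_7 + \rho_8$ is $\mathcal{R}_8$-equivalent to $g_7 + \frac{c_1}{8!}x^8 + \frac{c_2}{7!\,1!}x^7 y + \frac{c_3}{6!\,2!}x^6y^2$, where $$c_1 = \Bigl(\frac{\partial^2}{\partial x^2} - 3\frac{\partial^2}{\partial y^2}\Bigr)\Delta^3\rho_8 \in \mathbf{R}, \qquad c_2 = \frac{\partial^2}{\partial x\,\partial y}\Delta^3\rho_8 \in \mathbf{R}, \qquad c_3 = \frac{\partial^2}{\partial y^2}\Delta^3\rho_8 \in \mathbf{R}.$$ (3) For any homogeneous polynomials $\rho_8,\rho_9$ in $(x,y)$ of degrees $8$ and $9$ respectively and any function-germ $R_{10}$ with $\mathrm{ord}(R_{10}) \ge 10$, the germ $g_7 + \rho_8 + \rho_9 + R_{10}$ is $\mathcal{R}_9$-equivalent to $g_7 + \rho_8 + \frac{c_1}{9!}x^9 + \frac{c_2}{8!\,1!}x^8 y$, where $$c_1 = \frac{\partial}{\partial x}\Delta^4 \rho_9 \in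 \mathbf{R}, \qquad c_2 = \frac{\partial}{\partial y}\Delta^4\rho_9 \in \mathbf{R}.$$ (4) For any homogeneous polynomials $\rho_8,\rho_9,\rho_{10}$ in $(x,y)$ of degrees $8$, $9$ and $10$ respectively, the germ $g_7 + \rho_8 + \rho_9 + \rho_{10}$ is $\mathcal{R}_{10}$-equivalent to $g_7 + \rho_8 + \rho_9 + \frac{c}{10!}x^{10}$, where $c = \Delta^5 \rho_{10} \in \mathbf{R}$.
   Context: All function-germs are germs at the origin of $C^\infty$ functions on $\mathbf{R}^2$ with coordinates $(x,y)$, vanishing at the origin. $g_7 = \mathrm{Im}\,(x+iy)^7$, where $i = \sqrt{-1}$. $\Delta = \frac{\partial^2}{\partial x^2} + \frac{\partial^2}{\partial y^2}$ is the Laplacian; a function $h$ is harmonic if $\Delta h = 0$. The order $\mathrm{ord}(R)$ of a germ $R$ at the origin is the lowest degree of a non-zero term in its Taylor series at $\mathbf{0}$ (and $+\infty$ if the Taylor series is zero). Two germs $h_1,h_2$ are right-equivalent if there is a $C^\infty$ diffeomorphism-germ $\tau \colon (\mathbf{R}^2,\mathbf{0}) \to (\mathbf{R}^2,\mathbf{0})$ with $h_1 \circ \tau = h_2$; they are right-equivalent by a linear conformal diffeomorphism-germ if $\tau$ can be taken to be a non-zero scalar multiple of an orthogonal linear map. The $k$-jet $j^k h(\mathbf{0})$ is the Taylor series of $h$ at the origin up to and including degree $k$. Two germs $h_1, h_2$ are $\mathcal{R}_k$-equivalent if there is a germ $\tilde{h}_2$ with $j^k \tilde{h}_2(\mathbf{0})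 = j^k h_2(\mathbf{0})$ such that $h_1$ is right-equivalent to $\tilde{h}_2$. *)

theory Defs
  imports "HOL-Analysis.Analysis" "HOL-Library.Extended_Nat"
begin

text \<open>A germ at the origin is given by a representative defined on all of \<open>real \<times> real\<close>; outside a
  neighbourhood of \<open>0\<close> its values are irrelevant. Polynomials are global functions.\<close>

subsection \<open>Smoothness\<close>

primrec Ck_on :: "nat \<Rightarrow> 'a set \<Rightarrow> ('a::real_normed_vector \<Rightarrow> 'b::real_normed_vector) \<Rightarrow> bool" where
  "Ck_on 0 S f \<longleftrightarrow> continuous_on S f"
| "Ck_on (Suc k) S f \<longleftrightarrow>
     (\<forall>x\<in>S. f differentiable (at x)) \<and> (\<forall>v. Ck_on k S (\<lambda>x. frechet_derivative f (at x) v))"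

text \<open>Only used on open sets.\<close>

definition smooth_on :: "'a set \<Rightarrow> ('a::real_normed_vector \<Rightarrow> 'b::real_normed_vector) \<Rightarrow> bool" where
  "smooth_on S f \<longleftrightarrow> (\<forall>k. Ck_on k S f)"

definition function_germ :: "(real \<times> real \<Rightarrow> real) \<Rightarrow> bool" where
  "function_germ f \<longleftrightarrow> (\<exists>U. open U \<and> 0 \<in> U \<and> smooth_on U f) \<and> f 0 = 0"

subsection \<open>Partial derivatives, Taylor coefficients, order and jets\<close>

definition partial_x :: "(real \<times> real \<Rightarrow> real) \<Rightarrow> real \<times> real \<Rightarrow> real" where
  "partial_x f = (\<lambda>(x, y). deriv (\<lambda>t. f (t, y)) x)"

definition partial_y :: "(real \<times> real \<Rightarrow> real) \<Rightarrow> real \<times> real \<Rightarrow> real" where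
  "partial_y f = (\<lambda>(x, y). deriv (\<lambda>t. f (x, t)) y)"

definition laplacian :: "(real \<times> real \<Rightarrow> real) \<Rightarrow> real \<times> real \<Rightarrow> real" where
  "laplacian f = (\<lambda>p. partial_x (partial_x f) p + partial_y (partial_y f) p)"

definition harmonic :: "(real \<times> real \<Rightarrow> real) \<Rightarrow> bool" where
  "harmonic f \<longleftrightarrow> (\<forall>p. laplacian f p = 0)"

definition taylor_coeff :: "(real \<times> real \<Rightarrow> real) \<Rightarrow> nat \<Rightarrow> nat \<Rightarrow> real" where
  "taylor_coeff f i j = (partial_x ^^ i) ((partial_y ^^ j) f) 0 / (fact i * fact j)"

text \<open>The infimum of the empty set is \<open>\<infinity>\<close>.\<close>

definition germ_order :: "(real \<times> real \<Rightarrow> real) \<Rightarrow> enat" where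
  "germ_order f = Inf {enat (i + j) | i j. taylor_coeff f i j \<noteq> 0}"

text \<open>A jet is a truncated formal power series, given by its coefficients of \<open>x\<^sup>i y\<^sup>j\<close>.\<close>

definition jet :: "nat \<Rightarrow> (real \<times> real \<Rightarrow> real) \<Rightarrow> nat \<Rightarrow> nat \<Rightarrow> real" where
  "jet k f = (\<lambda>i j. if i + j \<le> k then taylor_coeff f i j else 0)"

subsection \<open>Homogeneous polynomials\<close>

definition homogeneous_poly :: "nat \<Rightarrow> (real \<times> real \<Rightarrow> real) \<Rightarrow> bool" where
  "homogeneous_poly n f \<longleftrightarrow> (\<exists>a. \<forall>x y. f (x, y) = (\<Sum>i\<le>n. a i * x ^ (n - i) * y ^ i))"

definition g7 :: "real \<times> real \<Rightarrow> real" where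
  "g7 = (\<lambda>(x, y). Im ((of_real x + \<i> * of_real y) ^ 7))"

subsection \<open>Right-equivalence\<close>

definition diffeo_germ :: "(real \<times> real \<Rightarrow> real \<times> real) \<Rightarrow> bool" where
  "diffeo_germ \<tau> \<longleftrightarrow> \<tau> 0 = 0 \<and>
     (\<exists>U V \<sigma>. open U \<and> 0 \<in> U \<and> open V \<and> 0 \<in> V \<and>
        homeomorphism U V \<tau> \<sigma> \<and> smooth_on U \<tau> \<and> smooth_on V \<sigma>)"

definition right_equivalent_by ::
  "(real \<times> real \<Rightarrow> real \<times> real) \<Rightarrow> (real \<times> real \<Rightarrow> real) \<Rightarrow> (real \<times> real \<Rightarrow> real) \<Rightarrow> bool" where
  "right_equivalent_by \<tau> f g \<longleftrightarrow> diffeo_germ \<tau> \<and> (\<forall>\<^sub>F p in nhds 0. (f \<circ> \<tau>) p = g p)"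

definition right_equivalent :: "(real \<times> real \<Rightarrow> real) \<Rightarrow> (real \<times> real \<Rightarrow> real) \<Rightarrow> bool" where
  "right_equivalent f g \<longleftrightarrow> (\<exists>\<tau>. right_equivalent_by \<tau> f g)"

definition linear_conformal :: "(real \<times> real \<Rightarrow> real \<times> real) \<Rightarrow> bool" where
  "linear_conformal \<tau> \<longleftrightarrow>
     (\<exists>c T. c \<noteq> 0 \<and> orthogonal_transformation T \<and> \<tau> = (\<lambda>p. c *\<^sub>R T p))"

definition right_equivalent_linear_conformal ::
  "(real \<times> real \<Rightarrow> real) \<Rightarrow> (real \<times> real \<Rightarrow> real) \<Rightarrow> bool" where
  "right_equivalent_linear_conformal f g \<longleftrightarrow> (\<exists>\<tau>. linear_conformal \<tau> \<and> right_equivalent_by \<tau> f g)"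

definition R_equivalent :: "nat \<Rightarrow> (real \<times> real \<Rightarrow> real) \<Rightarrow> (real \<times> real \<Rightarrow> real) \<Rightarrow> bool" where
  "R_equivalent k f g \<longleftrightarrow>
     (\<exists>g'. function_germ g' \<and> jet k g' = jet k g \<and> right_equivalent f g')"

end

theory Submission
  imports Defs
begin

text \<open>Identify the plane with the complex numbers, so \<open>g7 = Im z\<^sup>7\<close> and \<open>d g7 (w) = 7 Im (z\<^sup>6 w)\<close>. For
  homogeneous \<open>w\<close> of degree \<open>d \<ge> 2\<close>, pulling back by the diffeomorphism-germ \<open>z \<mapsto> z + w\<close> changes
  \<open>g7 + \<rho>\<close>, with \<open>\<rho>\<close> of order at least 8, by \<open>7 Im (z\<^sup>6 w)\<close> up to terms of degree greater than
  \<open>n = d + 6\<close>. The forms \<open>Im (z\<^sup>6 w)\<close> span the kernel of \<open>\<Delta>\<^sup>3\<close>, \<open>\<Delta>\<^sup>4\<close>, \<open>\<Delta>\<^sup>5\<close> in degree \<open>n = 8, 9, 10\<close>, since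
  \<open>\<Delta>\<close> acts as \<open>4 \<partial>\<^sub>z \<partial>\<^bsub>z*\<^esub>\<close>, writing \<open>z*\<close> for the conjugate. Hence the part of degree \<open>n\<close> can be replaced by
  any form with the same iterated Laplacian. In degree 7, a harmonic form is \<open>Im (c z\<^sup>7)\<close>, and \<open>c\<close> is
  absorbed by a complex rescaling.\<close>

subsection \<open>Calculus of smooth maps\<close>

text \<open>Every form of degree \<open>n\<close> is a combination of real and imaginary parts of
  monomials \<open>z^a zbar^b\<close> with \<open>a + b = n\<close>, and the \<open>k\<close>-th
  power of the Laplacian kills such a monomial exactly when \<open>min a b < k\<close>. The products
  \<open>z^6 w\<close> with \<open>w\<close> of degree \<open>d = n - 6\<close> supply all
  \<open>z^(n-j) zbar^j\<close> with \<open>j \<le> d\<close>. For \<open>n\<close> = 8, 9, 10 this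
  leaves the monomials with both exponents at least 3, 4, 5, of real dimension 3, 2, 1: the number
  of coefficients in the three normal forms. These coefficients are dual to the chosen monomials.
  The third power of the Laplacian sends \<open>x^8\<close>, \<open>x^7 y\<close>,
  \<open>x^6 y^2\<close> to \<open>(8!/2) x^2\<close>, \<open>7! x y\<close>,
  \<open>6! (3 x^2 + y^2)\<close>; the factor 3 in the last one is why \<open>c1\<close> subtracts
  three times the second \<open>y\<close>-derivative. In degrees 9 and 10 the images of
  \<open>x^9\<close>, \<open>x^8 y\<close>, \<open>x^10\<close> are \<open>9! x\<close>,
  \<open>8! y\<close>, \<open>10!\<close>. The kernels only explain the result. The check is made on
  coefficients: an explicit vector field is given for each form, and what it leaves is compared with
  the coefficients of the iterated Laplacian.\<close>

abbreviation dir_deriv ::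
  "('a::real_normed_vector \<Rightarrow> 'b::real_normed_vector) \<Rightarrow> 'a \<Rightarrow> 'a \<Rightarrow> 'b" where
  "dir_deriv f v \<equiv> (\<lambda>x. frechet_derivative f (at x) v)"

lemma dir_deriv_eq:
  "(f has_derivative f') (at x) \<Longrightarrow> dir_deriv f v x = f' v"
  by (simp add: frechet_derivative_at[symmetric])

lemma has_derivative_dir_deriv:
  "f differentiable (at x) \<Longrightarrow> (f has_derivative (\<lambda>v. dir_deriv f v x)) (at x)"
  by (simp add: frechet_derivative_works)

lemma dir_deriv_cong:
  assumes "open S" "x \<in> S" "\<And>y. y \<in> S \<Longrightarrow> f y = g y" "f differentiable (at x)"
  shows "dir_deriv f v x = dir_deriv g v x"
  using frechet_derivative_transform_within_open[OF assms(4,1,2,3)] by simp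

text \<open>The direction \<open>dir_deriv g v x\<close> varies with \<open>x\<close>, whereas
  \<open>Ck_on\<close> and \<open>vanishes\<close> speak of fixed directions. Expanding it in the
  basis gives a sum of products in which \<open>f\<close> is differentiated only in fixed
  directions, so that inductions on the order can proceed.\<close>

lemma dir_deriv_compose:
  fixes f :: "'a::euclidean_space \<Rightarrow> 'b::real_normed_vector"
    and g :: "'c::real_normed_vector \<Rightarrow> 'a"
  assumes "f differentiable (at (g x))" "g differentiable (at x)"
  shows "dir_deriv (\<lambda>x. f (g x)) v x = (\<Sum>b\<in>Basis. (dir_deriv g v x \<bullet> b) *\<^sub>R dir_deriv f b (g x))"
proof -
  have lin: "linear (\<lambda>w. dir_deriv f w (g x))"
    using assms(1) by (simp add: linear_frechet_derivative)
  have "dir_deriv (\<lambda>x. f (g x)) v x = dir_deriv f (dir_deriv g v x) (g x)"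
    using frechet_derivative_compose[OF assms(2,1)] by (simp add: o_def)
  also have "\<dots> = (\<Sum>b\<in>Basis. (dir_deriv g v x \<bullet> b) *\<^sub>R dir_deriv f b (g x))"
    by (subst euclidean_representation[of "dir_deriv g v x", symmetric])
       (simp add: linear_sum[OF lin] linear_scale[OF lin] del: euclidean_representation)
  finally show ?thesis .
qed

text \<open>The inductions for sums, products, compositions and inverses share one scheme: compute
  the directional derivative on \<open>S\<close> by a differentiation rule, show that the resulting
  formula is regular, and transfer by this lemma. Openness of \<open>S\<close> makes agreement on
  \<open>S\<close> carry over to derivatives.\<close>

lemma Ck_on_cong:
  assumes "open S" "\<And>x. x \<in> S \<Longrightarrow> f x = g x" "Ck_on k S f"
  shows "Ck_on k S g"
  using assms(2,3)
proof (induction k arbitrary: f g)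
  case 0
  then show ?case by (simp cong: continuous_on_cong)
next
  case (Suc k)
  have df: "f differentiable (at x)" if "x \<in> S" for x using Suc that by simp
  have "g differentiable (at x)" if "x \<in> S" for x
    using df[OF that] \<open>open S\<close> Suc.prems(1) that
    by (meson differentiable_def has_derivative_transform_within_open)
  moreover have "Ck_on k S (dir_deriv g v)" for v
  proof (rule Suc.IH)
    show "Ck_on k S (dir_deriv f v)" using Suc.prems by simp
    show "dir_deriv f v x = dir_deriv g v x" if "x \<in> S" for x
      using dir_deriv_cong[OF \<open>open S\<close> that Suc.prems(1) df[OF that]] .
  qed
  ultimately show ?case by simp
qed

lemma Ck_on_SucD: "Ck_on (Suc k) S f \<Longrightarrow> Ck_on k S f"
proof (induction k arbitrary: f)
  case 0
  then show ?case
    by (auto intro!: continuous_at_imp_continuous_on differentiable_imp_continuous_within)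
qed auto

lemma Ck_on_subset: "Ck_on k S f \<Longrightarrow> T \<subseteq> S \<Longrightarrow> Ck_on k T f"
  by (induction k arbitrary: f) (auto intro: continuous_on_subset)

lemma Ck_on_const: "Ck_on k S (\<lambda>x. c)"
  by (induction k arbitrary: c) simp_all

lemma Ck_on_bounded_linear:
  assumes "bounded_linear f"
  shows "Ck_on k S f"
proof (cases k)
  case 0
  then show ?thesis by (simp add: assms linear_continuous_on)
next
  case (Suc k)
  have "dir_deriv f v = (\<lambda>x. f v)" for v
    using bounded_linear_imp_has_derivative[OF assms] by (intro ext) (rule dir_deriv_eq)
  then show ?thesis
    by (simp add: Suc assms bounded_linear_imp_differentiable Ck_on_const)
qed

lemma Ck_on_linear_compose:
  assumes "bounded_linear h" "open S" "Ck_on k S f"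
  shows "Ck_on k S (\<lambda>x. h (f x))"
  using assms(3)
proof (induction k arbitrary: f)
  case 0
  then show ?case using assms(1)
    by (simp add: bounded_linear.continuous_on)
next
  case (Suc k)
  have der: "((\<lambda>x. h (f x)) has_derivative (\<lambda>v. h (dir_deriv f v x))) (at x)" if "x \<in> S" for x
    using Suc.prems that by (intro bounded_linear.has_derivative[OF assms(1)] has_derivative_dir_deriv) auto
  show ?case
  proof (simp, intro conjI ballI allI)
    fix v
    show "Ck_on k S (dir_deriv (\<lambda>x. h (f x)) v)"
      by (rule Ck_on_cong[OF \<open>open S\<close> _ Suc.IH[of "dir_deriv f v"]])
         (use Suc.prems dir_deriv_eq[OF der] in auto)
  qed (use der in \<open>auto simp: differentiable_def\<close>)
qed

lemma Ck_on_add: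
  assumes "open S" "Ck_on k S f" "Ck_on k S g"
  shows "Ck_on k S (\<lambda>x. f x + g x)"
  using assms(2,3)
proof (induction k arbitrary: f g)
  case 0
  then show ?case by (simp add: continuous_on_add)
next
  case (Suc k)
  have der: "((\<lambda>x. f x + g x) has_derivative (\<lambda>v. dir_deriv f v x + dir_deriv g v x)) (at x)"
    if "x \<in> S" for x
    using Suc.prems that by (intro has_derivative_add has_derivative_dir_deriv) auto
  show ?case
  proof (simp, intro conjI ballI allI)
    fix v
    show "Ck_on k S (dir_deriv (\<lambda>x. f x + g x) v)"
      by (rule Ck_on_cong[OF \<open>open S\<close> _ Suc.IH[of "dir_deriv f v" "dir_deriv g v"]])
         (use Suc.prems dir_deriv_eq[OF der] in auto)
  qed (use der in \<open>auto simp: differentiable_def\<close>)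
qed

lemma Ck_on_sum:
  assumes "open S" "\<And>i. i \<in> I \<Longrightarrow> Ck_on k S (f i)"
  shows "Ck_on k S (\<lambda>x. \<Sum>i\<in>I. f i x)"
  using assms(2)
  by (induction I rule: infinite_finite_induct) (auto intro: Ck_on_const Ck_on_add[OF \<open>open S\<close>])

lemma bounded_bilinear_has_derivative:
  assumes "bounded_bilinear h" "f differentiable (at x)" "g differentiable (at x)"
  shows "((\<lambda>x. h (f x) (g x)) has_derivative (\<lambda>v. h (f x) (dir_deriv g v x) + h (dir_deriv f v x) (g x))) (at x)"
  using assms by (intro bounded_bilinear.FDERIV has_derivative_dir_deriv)

text \<open>The Leibniz formula also contains the undifferentiated factors, which have one order
  more than the induction hypothesis takes; hence the descent by \<open>Ck_on_SucD\<close>. A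
  general bilinear \<open>h\<close> covers real and complex products and scaling at once.\<close>

lemma Ck_on_bilinear:
  assumes bil: "bounded_bilinear h" and "open S" "Ck_on k S f" "Ck_on k S g"
  shows "Ck_on k S (\<lambda>x. h (f x) (g x))"
  using assms(3,4)
proof (induction k arbitrary: f g)
  case 0
  then show ?case by (simp add: bounded_bilinear.continuous_on[OF bil])
next
  case (Suc k)
  have der: "((\<lambda>x. h (f x) (g x)) has_derivative
      (\<lambda>v. h (f x) (dir_deriv g v x) + h (dir_deriv f v x) (g x))) (at x)"
    if "x \<in> S" for x
    using Suc.prems that by (intro bounded_bilinear_has_derivative bil) auto
  show ?case
  proof (simp, intro conjI ballI allI)
    fix v
    have "Ck_on k S (\<lambda>x. h (f x) (dir_deriv g v x) + h (dir_deriv f v x) (g x))"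
      using Suc.prems Ck_on_SucD[OF Suc.prems(1)] Ck_on_SucD[OF Suc.prems(2)]
      by (intro Ck_on_add \<open>open S\<close> Suc.IH) auto
    then show "Ck_on k S (dir_deriv (\<lambda>x. h (f x) (g x)) v)"
      by (rule Ck_on_cong[OF \<open>open S\<close>, rotated]) (use dir_deriv_eq[OF der] in auto)
  qed (use der in \<open>auto simp: differentiable_def\<close>)
qed

text \<open>The chain rule replaces \<open>f\<close> by its directional derivatives and keeps the
  inner map, so the induction generalizes over \<open>f\<close> and holds \<open>g\<close>
  fixed.\<close>

lemma Ck_on_compose:
  fixes f :: "'a::euclidean_space \<Rightarrow> 'b::real_normed_vector"
    and g :: "'c::real_normed_vector \<Rightarrow> 'a"
  assumes "open S" "Ck_on k T f" "Ck_on k S g" "g ` S \<subseteq> T"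
  shows "Ck_on k S (\<lambda>x. f (g x))"
  using assms(2,3)
proof (induction k arbitrary: f)
  case 0
  then show ?case using assms(4)
    by (auto intro: continuous_on_compose2)
next
  case (Suc k)
  have diff: "f differentiable (at (g x))" "g differentiable (at x)" if "x \<in> S" for x
    using Suc.prems that assms(4) by auto
  show ?case
  proof (simp, intro conjI ballI allI)
    fix x assume "x \<in> S"
    then show "(\<lambda>x. f (g x)) differentiable (at x)"
      using differentiable_chain_at[OF diff(2,1)] by (simp add: o_def)
  next
    fix v
    have "Ck_on k S (\<lambda>x. \<Sum>b\<in>Basis. (dir_deriv g v x \<bullet> b) *\<^sub>R dir_deriv f b (g x))"
      using Suc.prems Ck_on_SucD[OF Suc.prems(2)]
      by (intro Ck_on_sum \<open>open S\<close> Ck_on_bilinear[OF bounded_bilinear_scaleR] Suc.IH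
          Ck_on_linear_compose[OF bounded_linear_inner_left]) auto
    then show "Ck_on k S (dir_deriv (\<lambda>x. f (g x)) v)"
      by (rule Ck_on_cong[OF \<open>open S\<close>, rotated]) (use dir_deriv_compose diff in metis)
  qed
qed

text \<open>The derivative is built from \<open>inverse (f x)\<close> itself and the derivative of
  \<open>f\<close>, so the induction hypothesis for the same \<open>f\<close> suffices.\<close>

lemma Ck_on_inverse:
  fixes f :: "'a::real_normed_vector \<Rightarrow> 'b::real_normed_field"
  assumes "open S" "Ck_on k S f" "\<And>x. x \<in> S \<Longrightarrow> f x \<noteq> 0"
  shows "Ck_on k S (\<lambda>x. inverse (f x))"
  using assms(2)
proof (induction k)
  case 0
  then show ?case using assms(3) by (auto intro: continuous_on_inverse)
next
  case (Suc k)
  have der: "((\<lambda>x. inverse (f x)) has_derivative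
      (\<lambda>v. - (inverse (f x) * dir_deriv f v x * inverse (f x)))) (at x)" if "x \<in> S" for x
    using Suc.prems that assms(3) by (intro Deriv.has_derivative_inverse has_derivative_dir_deriv) auto
  show ?case
  proof (simp, intro conjI ballI allI)
    fix v
    have "Ck_on k S (\<lambda>x. - (inverse (f x) * dir_deriv f v x * inverse (f x)))"
      using Suc.prems Ck_on_SucD[OF Suc.prems]
      by (intro Ck_on_linear_compose[OF bounded_linear_minus[OF bounded_linear_ident]]
          Ck_on_bilinear[OF bounded_bilinear_mult] \<open>open S\<close> Suc.IH) auto
    then show "Ck_on k S (dir_deriv (\<lambda>x. inverse (f x)) v)"
      by (rule Ck_on_cong[OF \<open>open S\<close>, rotated]) (use dir_deriv_eq[OF der] in auto)
  qed (use der in \<open>auto simp: differentiable_def\<close>)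
qed

section \<open>Closure properties of smooth maps\<close>

lemma smooth_on_differentiable: "smooth_on S f \<Longrightarrow> x \<in> S \<Longrightarrow> f differentiable (at x)"
  unfolding smooth_on_def using Ck_on.simps(2) by blast

lemma smooth_on_dir_deriv: "smooth_on S f \<Longrightarrow> smooth_on S (dir_deriv f v)"
  unfolding smooth_on_def using Ck_on.simps(2) by blast

lemma smooth_on_continuous: "smooth_on S f \<Longrightarrow> continuous_on S f"
  unfolding smooth_on_def using Ck_on.simps(1) by blast

lemma smooth_on_cong: "open S \<Longrightarrow> (\<And>x. x \<in> S \<Longrightarrow> f x = g x) \<Longrightarrow> smooth_on S f \<Longrightarrow> smooth_on S g"
  unfolding smooth_on_def using Ck_on_cong by blast

lemma smooth_on_subset: "smooth_on S f \<Longrightarrow> T \<subseteq> S \<Longrightarrow> smooth_on T f"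
  unfolding smooth_on_def using Ck_on_subset by blast

lemma smooth_on_const [simp, intro]: "smooth_on S (\<lambda>x. c)"
  unfolding smooth_on_def using Ck_on_const by blast

lemma smooth_on_bounded_linear: "bounded_linear f \<Longrightarrow> smooth_on S f"
  unfolding smooth_on_def using Ck_on_bounded_linear by blast

lemma smooth_on_linear_compose:
  "bounded_linear h \<Longrightarrow> open S \<Longrightarrow> smooth_on S f \<Longrightarrow> smooth_on S (\<lambda>x. h (f x))"
  unfolding smooth_on_def using Ck_on_linear_compose by blast

lemma smooth_on_add:
  "open S \<Longrightarrow> smooth_on S f \<Longrightarrow> smooth_on S g \<Longrightarrow> smooth_on S (\<lambda>x. f x + g x)"
  unfolding smooth_on_def using Ck_on_add by blast

lemma smooth_on_uminus:
  "open S \<Longrightarrow> smooth_on S f \<Longrightarrow> smooth_on S (\<lambda>x. - f x)"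
  using smooth_on_linear_compose[OF bounded_linear_minus[OF bounded_linear_ident]] by blast

lemma smooth_on_diff:
  "open S \<Longrightarrow> smooth_on S f \<Longrightarrow> smooth_on S g \<Longrightarrow> smooth_on S (\<lambda>x. f x - g x)"
  using smooth_on_add[of S f "\<lambda>x. - g x"] smooth_on_uminus[of S g] by simp

lemma smooth_on_sum:
  "open S \<Longrightarrow> (\<And>i. i \<in> I \<Longrightarrow> smooth_on S (f i)) \<Longrightarrow> smooth_on S (\<lambda>x. \<Sum>i\<in>I. f i x)"
  unfolding smooth_on_def by (intro allI Ck_on_sum) auto

lemma smooth_on_bilinear:
  "bounded_bilinear h \<Longrightarrow> open S \<Longrightarrow> smooth_on S f \<Longrightarrow> smooth_on S g \<Longrightarrow>
    smooth_on S (\<lambda>x. h (f x) (g x))"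
  unfolding smooth_on_def using Ck_on_bilinear by blast

lemmas smooth_on_mult = smooth_on_bilinear[OF bounded_bilinear_mult]
  and smooth_on_scaleR = smooth_on_bilinear[OF bounded_bilinear_scaleR]

lemma smooth_on_power:
  fixes f :: "'a::real_normed_vector \<Rightarrow> 'b::{real_normed_algebra,monoid_mult}"
  shows "open S \<Longrightarrow> smooth_on S f \<Longrightarrow> smooth_on S (\<lambda>x. f x ^ n)"
  by (induction n) (auto intro: smooth_on_mult)

lemma smooth_on_inverse:
  fixes f :: "'a::real_normed_vector \<Rightarrow> 'b::real_normed_field"
  shows "open S \<Longrightarrow> smooth_on S f \<Longrightarrow> (\<And>x. x \<in> S \<Longrightarrow> f x \<noteq> 0) \<Longrightarrow>
    smooth_on S (\<lambda>x. inverse (f x))"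
  unfolding smooth_on_def using Ck_on_inverse by blast

lemma smooth_on_compose:
  fixes f :: "'a::euclidean_space \<Rightarrow> 'b::real_normed_vector"
    and g :: "'c::real_normed_vector \<Rightarrow> 'a"
  shows "open S \<Longrightarrow> smooth_on T f \<Longrightarrow> smooth_on S g \<Longrightarrow> g ` S \<subseteq> T \<Longrightarrow> smooth_on S (\<lambda>x. f (g x))"
  unfolding smooth_on_def using Ck_on_compose by blast

lemma smooth_on_Pair:
  fixes f :: "'a::real_normed_vector \<Rightarrow> 'b::real_normed_vector" and g :: "'a \<Rightarrow> 'c::real_normed_vector"
  assumes "open S" "smooth_on S f" "smooth_on S g"
  shows "smooth_on S (\<lambda>x. (f x, g x))"
proof -
  have "smooth_on S (\<lambda>x. (f x, 0::'c))" "smooth_on S (\<lambda>x. (0::'b, g x))"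
    by (rule smooth_on_linear_compose[OF _ assms(1,2)] smooth_on_linear_compose[OF _ assms(1,3)],
        simp add: bounded_linear_Pair bounded_linear_ident bounded_linear_zero)+
  from smooth_on_add[OF assms(1) this] show ?thesis by simp
qed

lemma smooth_on_fst: "open S \<Longrightarrow> smooth_on S f \<Longrightarrow> smooth_on S (\<lambda>x. fst (f x))"
  by (rule smooth_on_linear_compose[OF bounded_linear_fst])

lemma smooth_on_snd: "open S \<Longrightarrow> smooth_on S f \<Longrightarrow> smooth_on S (\<lambda>x. snd (f x))"
  by (rule smooth_on_linear_compose[OF bounded_linear_snd])

lemma smooth_on_ident: "smooth_on S (\<lambda>x. x)"
  by (rule smooth_on_bounded_linear[OF bounded_linear_ident])

lemmas smooth_on_intros = smooth_on_const smooth_on_add smooth_on_uminus smooth_on_diff smooth_on_sum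
  smooth_on_mult smooth_on_power smooth_on_Pair smooth_on_fst smooth_on_snd smooth_on_ident

subsection \<open>Partial derivatives and their symmetry\<close>

lemma has_field_derivative_partial_x:
  fixes f :: "real \<times> real \<Rightarrow> real"
  assumes "f differentiable (at (x, y))"
  shows "((\<lambda>t. f (t, y)) has_field_derivative dir_deriv f (1, 0) (x, y)) (at x)"
proof -
  let ?f' = "\<lambda>v. dir_deriv f v (x, y)"
  have lin: "linear ?f'" using assms by (simp add: linear_frechet_derivative)
  have "((\<lambda>t. (t, y)) has_derivative (\<lambda>h. (h, 0))) (at x)"
    by (intro has_derivative_Pair has_derivative_ident has_derivative_const)
  then have "((\<lambda>t. f (t, y)) has_derivative (\<lambda>h. ?f' (h, 0))) (at x)"
    using has_derivative_dir_deriv[OF assms]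
    by (rule has_derivative_compose[of "\<lambda>t. (t, y)" "\<lambda>h. (h, 0)" x UNIV f ?f'])
  moreover have "(\<lambda>h. ?f' (h, 0)) = (*) (?f' (1, 0))"
  proof
    fix h :: real
    show "?f' (h, 0) = ?f' (1, 0) * h"
      using linear_scale[OF lin, of h "(1, 0)"] by (simp add: mult.commute)
  qed
  ultimately show ?thesis unfolding has_field_derivative_def by simp
qed

lemma has_field_derivative_partial_y:
  fixes f :: "real \<times> real \<Rightarrow> real"
  assumes "f differentiable (at (x, y))"
  shows "((\<lambda>t. f (x, t)) has_field_derivative dir_deriv f (0, 1) (x, y)) (at y)"
proof -
  let ?f' = "\<lambda>v. dir_deriv f v (x, y)"
  have lin: "linear ?f'" using assms by (simp add: linear_frechet_derivative)
  have "((\<lambda>t. (x, t)) has_derivative (\<lambda>h. (0, h))) (at y)"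
    by (intro has_derivative_Pair has_derivative_ident has_derivative_const)
  then have "((\<lambda>t. f (x, t)) has_derivative (\<lambda>h. ?f' (0, h))) (at y)"
    using has_derivative_dir_deriv[OF assms]
    by (rule has_derivative_compose[of "\<lambda>t. (x, t)" "\<lambda>h. (0, h)" y UNIV f ?f'])
  moreover have "(\<lambda>h. ?f' (0, h)) = (*) (?f' (0, 1))"
  proof
    fix h :: real
    show "?f' (0, h) = ?f' (0, 1) * h"
      using linear_scale[OF lin, of h "(0, 1)"] by (simp add: mult.commute)
  qed
  ultimately show ?thesis unfolding has_field_derivative_def by simp
qed

lemma partial_x_eq_dir_deriv:
  "f differentiable (at p) \<Longrightarrow> partial_x f p = dir_deriv f (1, 0) p"
  unfolding partial_x_def by (cases p) (use has_field_derivative_partial_x in \<open>auto intro: DERIV_imp_deriv\<close>)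

lemma partial_y_eq_dir_deriv:
  "f differentiable (at p) \<Longrightarrow> partial_y f p = dir_deriv f (0, 1) p"
  unfolding partial_y_def by (cases p) (use has_field_derivative_partial_y in \<open>auto intro: DERIV_imp_deriv\<close>)

lemma dir_deriv_eq_partials:
  fixes f :: "real \<times> real \<Rightarrow> real"
  assumes "f differentiable (at p)"
  shows "dir_deriv f v p = fst v * partial_x f p + snd v * partial_y f p"
proof -
  have lin: "linear (\<lambda>v. dir_deriv f v p)" using assms by (simp add: linear_frechet_derivative)
  have "v = fst v *\<^sub>R (1, 0) + snd v *\<^sub>R (0, 1)" by (cases v) simp
  then have "dir_deriv f v p = dir_deriv f (fst v *\<^sub>R (1, 0) + snd v *\<^sub>R (0, 1)) p" by simp
  also have "\<dots> = fst v * partial_x f p + snd v * partial_y f p"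
    using assms by (simp only: linear_add[OF lin] linear_scale[OF lin] real_scaleR_def
        partial_x_eq_dir_deriv partial_y_eq_dir_deriv)
  finally show ?thesis .
qed

lemma smooth_on_partial_x: "open S \<Longrightarrow> smooth_on S f \<Longrightarrow> smooth_on S (partial_x f)"
  by (rule smooth_on_cong[OF _ _ smooth_on_dir_deriv])
     (auto simp: partial_x_eq_dir_deriv smooth_on_differentiable)

lemma smooth_on_partial_y: "open S \<Longrightarrow> smooth_on S f \<Longrightarrow> smooth_on S (partial_y f)"
  by (rule smooth_on_cong[OF _ _ smooth_on_dir_deriv])
     (auto simp: partial_y_eq_dir_deriv smooth_on_differentiable)

lemma smooth_on_partial_x_funpow:
  "open S \<Longrightarrow> smooth_on S f \<Longrightarrow> smooth_on S ((partial_x ^^ n) f)"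
  by (induction n) (auto intro: smooth_on_partial_x)

lemma smooth_on_partial_y_funpow:
  "open S \<Longrightarrow> smooth_on S f \<Longrightarrow> smooth_on S ((partial_y ^^ n) f)"
  by (induction n) (auto intro: smooth_on_partial_y)

lemma partial_x_cong:
  assumes "open S" "smooth_on S f" "\<And>p. p \<in> S \<Longrightarrow> f p = g p" "p \<in> S"
  shows "partial_x f p = partial_x g p"
  using smooth_on_differentiable[OF assms(2,4)]
    smooth_on_differentiable[OF smooth_on_cong[OF assms(1,3,2)] assms(4)]
    dir_deriv_cong[OF assms(1,4,3)]
  by (simp add: partial_x_eq_dir_deriv)

lemma partial_y_cong:
  assumes "open S" "smooth_on S f" "\<And>p. p \<in> S \<Longrightarrow> f p = g p" "p \<in> S"
  shows "partial_y f p = partial_y g p"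
  using smooth_on_differentiable[OF assms(2,4)]
    smooth_on_differentiable[OF smooth_on_cong[OF assms(1,3,2)] assms(4)]
    dir_deriv_cong[OF assms(1,4,3)]
  by (simp add: partial_y_eq_dir_deriv)

lemma partial_x_funpow_cong:
  assumes "open S" "smooth_on S f" "\<And>p. p \<in> S \<Longrightarrow> f p = g p" "p \<in> S"
  shows "(partial_x ^^ n) f p = (partial_x ^^ n) g p"
  using assms(4)
proof (induction n arbitrary: p)
  case (Suc n)
  then show ?case
    using partial_x_cong[OF assms(1) smooth_on_partial_x_funpow[OF assms(1,2)]] by simp
qed (simp add: assms(3))

text \<open>Mean value theorem twice: along \<open>x\<close> for the increment
  \<open>f (x, b+h) - f (x, b)\<close>, then along \<open>y\<close> for \<open>partial_x f\<close>.
  The next lemma takes the same second difference in the other order; comparing the two gives the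
  symmetry of mixed partials.\<close>

lemma second_difference_mean_value:
  fixes f :: "real \<times> real \<Rightarrow> real"
  assumes "open S" "smooth_on S f" "h > 0" "{a..a+h} \<times> {b..b+h} \<subseteq> S"
  obtains q where "q \<in> {a..a+h} \<times> {b..b+h}"
    "f (a+h, b+h) - f (a+h, b) - f (a, b+h) + f (a, b) = h * h * partial_y (partial_x f) q"
proof -
  have diff: "f differentiable (at (x, y))" "partial_x f differentiable (at (x, y))"
    if "x \<in> {a..a+h}" "y \<in> {b..b+h}" for x y
    using assms(4) that
    by (auto intro!: smooth_on_differentiable[OF assms(2)]
        smooth_on_differentiable[OF smooth_on_partial_x[OF assms(1,2)]])
  have "\<exists>z. a < z \<and> z < a + h \<and> (f (a+h, b+h) - f (a+h, b)) - (f (a, b+h) - f (a, b))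
      = (a + h - a) * (partial_x f (z, b+h) - partial_x f (z, b))"
    using assms(3) diff(1)
    by (intro MVT2 DERIV_diff) (auto simp: partial_x_eq_dir_deriv intro!: has_field_derivative_partial_x)
  then obtain z where z: "a < z" "z < a + h"
    "(f (a+h, b+h) - f (a+h, b)) - (f (a, b+h) - f (a, b)) = h * (partial_x f (z, b+h) - partial_x f (z, b))"
    by auto
  have "\<exists>w. b < w \<and> w < b + h \<and> partial_x f (z, b+h) - partial_x f (z, b)
      = (b + h - b) * partial_y (partial_x f) (z, w)"
    using assms(3) diff(2) z(1,2)
    by (intro MVT2) (auto simp: partial_y_eq_dir_deriv intro!: has_field_derivative_partial_y)
  then obtain w where "b < w" "w < b + h"
    "partial_x f (z, b+h) - partial_x f (z, b) = h * partial_y (partial_x f) (z, w)"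
    by auto
  with z show ?thesis by (intro that[of "(z, w)"]) (auto simp: algebra_simps)
qed

lemma second_difference_mean_value':
  fixes f :: "real \<times> real \<Rightarrow> real"
  assumes "open S" "smooth_on S f" "h > 0" "{a..a+h} \<times> {b..b+h} \<subseteq> S"
  obtains q where "q \<in> {a..a+h} \<times> {b..b+h}"
    "f (a+h, b+h) - f (a+h, b) - f (a, b+h) + f (a, b) = h * h * partial_x (partial_y f) q"
proof -
  have diff: "f differentiable (at (x, y))" "partial_y f differentiable (at (x, y))"
    if "x \<in> {a..a+h}" "y \<in> {b..b+h}" for x y
    using assms(4) that
    by (auto intro!: smooth_on_differentiable[OF assms(2)]
        smooth_on_differentiable[OF smooth_on_partial_y[OF assms(1,2)]])
  have "\<exists>z. b < z \<and> z < b + h \<and> (f (a+h, b+h) - f (a, b+h)) - (f (a+h, b) - f (a, b))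
      = (b + h - b) * (partial_y f (a+h, z) - partial_y f (a, z))"
    using assms(3) diff(1)
    by (intro MVT2 DERIV_diff) (auto simp: partial_y_eq_dir_deriv intro!: has_field_derivative_partial_y)
  then obtain z where z: "b < z" "z < b + h"
    "(f (a+h, b+h) - f (a, b+h)) - (f (a+h, b) - f (a, b)) = h * (partial_y f (a+h, z) - partial_y f (a, z))"
    by auto
  have "\<exists>w. a < w \<and> w < a + h \<and> partial_y f (a+h, z) - partial_y f (a, z)
      = (a + h - a) * partial_x (partial_y f) (w, z)"
    using assms(3) diff(2) z(1,2)
    by (intro MVT2) (auto simp: partial_x_eq_dir_deriv intro!: has_field_derivative_partial_x)
  then obtain w where "a < w" "w < a + h"
    "partial_y f (a+h, z) - partial_y f (a, z) = h * partial_x (partial_y f) (w, z)"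
    by auto
  with z show ?thesis by (intro that[of "(w, z)"]) (auto simp: algebra_simps)
qed

lemma partial_x_partial_y_commute:
  assumes "open S" "smooth_on S f" "p \<in> S"
  shows "partial_x (partial_y f) p = partial_y (partial_x f) p"
proof -
  let ?X = "partial_x (partial_y f)" and ?Y = "partial_y (partial_x f)"
  have cont: "isCont ?X p" "isCont ?Y p"
    using assms smooth_on_continuous[OF smooth_on_partial_x[OF _ smooth_on_partial_y]]
      smooth_on_continuous[OF smooth_on_partial_y[OF _ smooth_on_partial_x]]
    by (auto simp: continuous_on_eq_continuous_at)
  obtain a b where p: "p = (a, b)" by (cases p)
  \<comment> \<open>The summand 0 gives the shape that \<open>field_le_epsilon\<close>
    expects.\<close>
  have "\<bar>?X p - ?Y p\<bar> \<le> 0 + e" if "e > 0" for e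
  proof -
    have "e / 2 > 0" using that by simp
    obtain d1 where d1: "d1 > 0" "ball p d1 \<subseteq> S"
      using assms(1,3) by (auto simp: open_contains_ball)
    obtain d2 where d2: "d2 > 0" "\<And>q. dist q p < d2 \<Longrightarrow> dist (?X q) (?X p) < e / 2"
      using cont(1) \<open>e / 2 > 0\<close> unfolding continuous_at_eps_delta by metis
    obtain d3 where d3: "d3 > 0" "\<And>q. dist q p < d3 \<Longrightarrow> dist (?Y q) (?Y p) < e / 2"
      using cont(2) \<open>e / 2 > 0\<close> unfolding continuous_at_eps_delta by metis
    \<comment> \<open>Points of the square are at distance at most \<open>2 * h\<close> from
      \<open>p\<close>, so a third of the smallest radius keeps them strictly inside all three
      balls.\<close>
    define h where "h = min d1 (min d2 d3) / 3"
    have h: "h > 0" "2 * h < d1" "2 * h < d2" "2 * h < d3" using d1 d2 d3 by (auto simp: h_def min_def)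
    have near: "dist q p \<le> 2 * h" if "q \<in> {a..a+h} \<times> {b..b+h}" for q
    proof -
      have "dist q p \<le> \<bar>fst q - a\<bar> + \<bar>snd q - b\<bar>"
        by (cases q) (simp add: p dist_Pair_Pair dist_real_def sqrt_sum_squares_le_sum_abs)
      then show ?thesis using that by (auto simp: mem_Times_iff)
    qed
    have "q \<in> S" if "q \<in> {a..a+h} \<times> {b..b+h}" for q
      using near[OF that] h(2) by (intro subsetD[OF d1(2)]) (simp add: dist_commute)
    then have sub: "{a..a+h} \<times> {b..b+h} \<subseteq> S" by blast
    obtain q1 where q1: "q1 \<in> {a..a+h} \<times> {b..b+h}"
      "f (a+h, b+h) - f (a+h, b) - f (a, b+h) + f (a, b) = h * h * ?Y q1"
      using second_difference_mean_value[OF assms(1,2) h(1) sub] .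
    obtain q2 where q2: "q2 \<in> {a..a+h} \<times> {b..b+h}"
      "f (a+h, b+h) - f (a+h, b) - f (a, b+h) + f (a, b) = h * h * ?X q2"
      using second_difference_mean_value'[OF assms(1,2) h(1) sub] .
    have "?X q2 = ?Y q1" using q1(2) q2(2) h(1) by simp
    moreover have "dist (?X q2) (?X p) < e / 2" "dist (?Y q1) (?Y p) < e / 2"
      using d2(2) d3(2) near[OF q1(1)] near[OF q2(1)] h by auto
    ultimately show ?thesis unfolding dist_real_def by linarith
  qed
  then have "\<bar>?X p - ?Y p\<bar> \<le> 0" by (rule field_le_epsilon)
  then show ?thesis by simp
qed

lemma partial_y_funpow_partial_x:
  assumes "open S" "smooth_on S f" "p \<in> S"
  shows "(partial_y ^^ n) (partial_x f) p = partial_x ((partial_y ^^ n) f) p"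
  using assms(3)
proof (induction n arbitrary: p)
  case (Suc n)
  have "(partial_y ^^ Suc n) (partial_x f) p = partial_y ((partial_y ^^ n) (partial_x f)) p" by simp
  also have "\<dots> = partial_y (partial_x ((partial_y ^^ n) f)) p"
    using Suc.IH Suc.prems assms
    by (intro partial_y_cong[of S]) (auto intro!: smooth_on_partial_y_funpow smooth_on_partial_x)
  also have "\<dots> = partial_x ((partial_y ^^ Suc n) f) p"
    using partial_x_partial_y_commute[OF assms(1) smooth_on_partial_y_funpow[OF assms(1,2)] Suc.prems]
    by simp
  finally show ?case .
qed simp

subsection \<open>Order of vanishing and Taylor coefficients\<close>

text \<open>Vanishing at 0 of all iterated directional derivatives of order below \<open>k\<close>.
  Unlike a condition on Taylor coefficients in \<open>x\<close> and \<open>y\<close>, this makes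
  sense for complex-valued maps and is compatible with the Leibniz and chain rules. The two notions
  are matched on smooth germs by \<open>germ_order_ge_iff_vanishes\<close>.\<close>

primrec vanishes :: "nat \<Rightarrow> ('a::real_normed_vector \<Rightarrow> 'b::real_normed_vector) \<Rightarrow> bool" where
  "vanishes 0 f \<longleftrightarrow> True"
| "vanishes (Suc k) f \<longleftrightarrow> f 0 = 0 \<and> (\<forall>v. vanishes k (\<lambda>x. frechet_derivative f (at x) v))"

lemma vanishes_cong:
  assumes "open S" "0 \<in> S" "smooth_on S f" "\<And>x. x \<in> S \<Longrightarrow> f x = g x" "vanishes k f"
  shows "vanishes k g"
  using assms(3-)
proof (induction k arbitrary: f g)
  case (Suc k)
  have "vanishes k (dir_deriv g v)" for v
  proof (rule Suc.IH)
    show "smooth_on S (dir_deriv f v)" using Suc.prems by (simp add: smooth_on_dir_deriv)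
    show "vanishes k (dir_deriv f v)" using Suc.prems by simp
    show "dir_deriv f v x = dir_deriv g v x" if "x \<in> S" for x
      using dir_deriv_cong[OF assms(1) that Suc.prems(2) smooth_on_differentiable[OF Suc.prems(1) that]] .
  qed
  then show ?case using Suc.prems assms(2) by auto
qed simp

lemma vanishes_SucD: "vanishes (Suc k) f \<Longrightarrow> vanishes k f"
  by (induction k arbitrary: f) auto

lemma vanishes_mono: "l \<le> k \<Longrightarrow> vanishes k f \<Longrightarrow> vanishes l f"
  by (induction rule: dec_induct) (auto intro: vanishes_SucD simp del: vanishes.simps)

lemma vanishes_dir_deriv: "vanishes k f \<Longrightarrow> vanishes (k - 1) (dir_deriv f v)"
  by (cases k) auto

lemma vanishes_zero: "vanishes k (\<lambda>x. 0)"
  by (induction k) auto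

lemma vanishes_add:
  assumes "open S" "0 \<in> S" "smooth_on S f" "smooth_on S g" "vanishes k f" "vanishes k g"
  shows "vanishes k (\<lambda>x. f x + g x)"
  using assms(3-)
proof (induction k arbitrary: f g)
  case (Suc k)
  have "vanishes k (dir_deriv (\<lambda>x. f x + g x) v)" for v
  proof (rule vanishes_cong[OF assms(1,2)])
    show "vanishes k (\<lambda>x. dir_deriv f v x + dir_deriv g v x)"
      using Suc.prems by (intro Suc.IH smooth_on_dir_deriv) auto
    show "smooth_on S (\<lambda>x. dir_deriv f v x + dir_deriv g v x)"
      using Suc.prems assms(1) by (intro smooth_on_add smooth_on_dir_deriv) auto
    show "dir_deriv f v x + dir_deriv g v x = dir_deriv (\<lambda>x. f x + g x) v x" if "x \<in> S" for x
      using Suc.prems that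
      by (intro dir_deriv_eq[symmetric] has_derivative_add has_derivative_dir_deriv smooth_on_differentiable)
  qed
  then show ?case using Suc.prems by simp
qed simp

lemma vanishes_sum:
  assumes "open S" "0 \<in> S" "\<And>i. i \<in> I \<Longrightarrow> smooth_on S (f i)" "\<And>i. i \<in> I \<Longrightarrow> vanishes k (f i)"
  shows "vanishes k (\<lambda>x. \<Sum>i\<in>I. f i x)"
  using assms(3,4)
  by (induction I rule: infinite_finite_induct)
     (auto intro!: vanishes_zero vanishes_add[OF assms(1,2)] smooth_on_sum[OF assms(1)])

text \<open>Each Leibniz term lowers one of the two orders by one. The slack
  \<open>m \<le> k + l\<close>, in place of an equality, lets the induction pass through the
  truncated \<open>k - 1\<close> and \<open>l - 1\<close> when an order is already 0.\<close>

lemma vanishes_bilinear: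
  assumes "bounded_bilinear h" "open S" "0 \<in> S" "smooth_on S f" "smooth_on S g"
    "vanishes k f" "vanishes l g" "m \<le> k + l"
  shows "vanishes m (\<lambda>x. h (f x) (g x))"
  using assms(4-)
proof (induction m arbitrary: f g k l)
  case (Suc m)
  \<comment> \<open>\<open>Suc m \<le> k + l\<close> forces \<open>k\<close> or \<open>l\<close> to
    be positive, so one factor is zero at the origin.\<close>
  have zero: "h (f 0) (g 0) = 0"
    using Suc.prems assms(1)
    by (cases k; cases l) (auto simp: bounded_bilinear.zero_left bounded_bilinear.zero_right)
  have "vanishes m (dir_deriv (\<lambda>x. h (f x) (g x)) v)" for v
  proof (rule vanishes_cong[OF assms(2,3)])
    show "vanishes m (\<lambda>x. h (f x) (dir_deriv g v x) + h (dir_deriv f v x) (g x))"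
      using Suc.prems assms(2,3)
      by (intro vanishes_add[OF assms(2,3)] smooth_on_bilinear[OF assms(1,2)] smooth_on_dir_deriv
          Suc.IH[of f "dir_deriv g v" k "l - 1"] Suc.IH[of "dir_deriv f v" g "k - 1" l]
          vanishes_dir_deriv) auto
    show "smooth_on S (\<lambda>x. h (f x) (dir_deriv g v x) + h (dir_deriv f v x) (g x))"
      using Suc.prems by (intro smooth_on_add smooth_on_bilinear[OF assms(1)] smooth_on_dir_deriv assms)
    show "h (f x) (dir_deriv g v x) + h (dir_deriv f v x) (g x) = dir_deriv (\<lambda>x. h (f x) (g x)) v x"
      if "x \<in> S" for x
      using Suc.prems that
      by (intro dir_deriv_eq[symmetric] bounded_bilinear_has_derivative assms(1) smooth_on_differentiable)
  qed
  then show ?case using zero by simp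
qed simp

lemmas vanishes_mult = vanishes_bilinear[OF bounded_bilinear_mult]

lemma vanishes_power:
  fixes f :: "'a::real_normed_vector \<Rightarrow> 'b::real_normed_field"
  assumes "open S" "0 \<in> S" "smooth_on S f" "vanishes k f"
  shows "vanishes (n * k) (\<lambda>x. f x ^ n)"
proof (induction n)
  case (Suc n)
  then show ?case
    using vanishes_mult[OF assms(1-3) smooth_on_power[OF assms(1,3)] assms(4) Suc] by simp
qed simp

lemma vanishes_linear_compose:
  assumes "bounded_linear h" "open S" "0 \<in> S" "smooth_on S f" "vanishes k f"
  shows "vanishes k (\<lambda>x. h (f x))"
  using assms(4-)
proof (induction k arbitrary: f)
  case (Suc k)
  have "vanishes k (dir_deriv (\<lambda>x. h (f x)) v)" for v
  proof (rule vanishes_cong[OF assms(2,3)])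
    show "vanishes k (\<lambda>x. h (dir_deriv f v x))"
      using Suc.prems by (intro Suc.IH smooth_on_dir_deriv) auto
    show "smooth_on S (\<lambda>x. h (dir_deriv f v x))"
      by (rule smooth_on_linear_compose[OF assms(1,2) smooth_on_dir_deriv[OF Suc.prems(1)]])
    show "h (dir_deriv f v x) = dir_deriv (\<lambda>x. h (f x)) v x" if "x \<in> S" for x
      using dir_deriv_eq[OF bounded_linear.has_derivative[OF assms(1)
          has_derivative_dir_deriv[OF smooth_on_differentiable[OF Suc.prems(1) that]]]]
      by simp
  qed
  then show ?case using Suc.prems linear_0[OF bounded_linear.linear[OF assms(1)]] by simp
qed simp

text \<open>Each term of the chain rule is a factor from \<open>g\<close>, counted with order 0,
  times a directional derivative of \<open>f\<close> composed with \<open>g\<close>, which has the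
  required order by induction.\<close>

lemma vanishes_compose:
  fixes f :: "'a::euclidean_space \<Rightarrow> 'b::real_normed_vector"
    and g :: "'c::real_normed_vector \<Rightarrow> 'a"
  assumes "open S" "0 \<in> S" "smooth_on T f" "smooth_on S g" "g ` S \<subseteq> T" "g 0 = 0" "vanishes k f"
  shows "vanishes k (\<lambda>x. f (g x))"
  using assms(3,7)
proof (induction k arbitrary: f)
  case (Suc k)
  have "vanishes k (dir_deriv (\<lambda>x. f (g x)) v)" for v
  proof (rule vanishes_cong[OF assms(1,2)])
    have sm: "smooth_on S (\<lambda>x. dir_deriv g v x \<bullet> b)" "smooth_on S (\<lambda>x. dir_deriv f b (g x))" for b
      by (rule smooth_on_linear_compose[OF bounded_linear_inner_left assms(1) smooth_on_dir_deriv[OF assms(4)]],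
          rule smooth_on_compose[OF assms(1) smooth_on_dir_deriv[OF Suc.prems(1)] assms(4,5)])
    have van: "vanishes k (\<lambda>x. dir_deriv f b (g x))" for b
      by (rule Suc.IH[OF smooth_on_dir_deriv[OF Suc.prems(1)]]) (use Suc.prems(2) in simp)
    show "smooth_on S (\<lambda>x. \<Sum>b\<in>Basis. (dir_deriv g v x \<bullet> b) *\<^sub>R dir_deriv f b (g x))"
      by (intro smooth_on_sum smooth_on_scaleR sm assms)
    show "vanishes k (\<lambda>x. \<Sum>b\<in>Basis. (dir_deriv g v x \<bullet> b) *\<^sub>R dir_deriv f b (g x))"
      using vanishes_bilinear[OF bounded_bilinear_scaleR assms(1,2) sm, where k = 0 and l = k] van
      by (intro vanishes_sum[OF assms(1,2)] smooth_on_scaleR sm assms) auto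
    show "(\<Sum>b\<in>Basis. (dir_deriv g v x \<bullet> b) *\<^sub>R dir_deriv f b (g x)) = dir_deriv (\<lambda>x. f (g x)) v x"
      if "x \<in> S" for x
      using that assms Suc.prems
      by (intro dir_deriv_compose[symmetric]) (auto intro: smooth_on_differentiable)
  qed
  then show ?case using Suc.prems assms(6) by simp
qed simp

lemma vanishes_imp_taylor_coeff_eq_0:
  assumes "open S" "0 \<in> S" "smooth_on S f" "vanishes k f" "i + j < k"
  shows "taylor_coeff f i j = 0"
proof -
  have y: "vanishes (k - j) ((partial_y ^^ j) f)" for j
  proof (induction j)
    case (Suc j)
    have sm: "smooth_on S ((partial_y ^^ j) f)" by (rule smooth_on_partial_y_funpow[OF assms(1,3)])
    show ?case
      using vanishes_cong[OF assms(1,2) smooth_on_dir_deriv[OF sm] _ vanishes_dir_deriv[OF Suc],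
          where g = "(partial_y ^^ Suc j) f"] smooth_on_differentiable[OF sm]
      by (simp add: partial_y_eq_dir_deriv)
  qed (simp add: assms)
  have "vanishes (k - j - i) ((partial_x ^^ i) ((partial_y ^^ j) f))"
  proof (induction i)
    case (Suc i)
    have sm: "smooth_on S ((partial_x ^^ i) ((partial_y ^^ j) f))"
      by (intro smooth_on_partial_x_funpow smooth_on_partial_y_funpow assms)
    show ?case
      using vanishes_cong[OF assms(1,2) smooth_on_dir_deriv[OF sm] _ vanishes_dir_deriv[OF Suc],
          where g = "(partial_x ^^ Suc i) ((partial_y ^^ j) f)"] smooth_on_differentiable[OF sm]
      by (simp add: partial_x_eq_dir_deriv)
  qed (simp add: y)
  then have "(partial_x ^^ i) ((partial_y ^^ j) f) 0 = 0"
    using assms(5) by (cases "k - j - i") auto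
  then show ?thesis by (simp add: taylor_coeff_def)
qed

text \<open>The coefficients of \<open>partial_x f\<close> and \<open>partial_y f\<close> are
  multiples of those of \<open>f\<close>, one degree higher. For \<open>partial_y f\<close> this is
  a shift of the iteration. In \<open>taylor_coeff\<close> the \<open>y\<close>-derivatives are
  taken first, so for \<open>partial_x f\<close> the inner \<open>x\<close>-derivative has to be
  moved outside: here the symmetry of mixed partials enters.\<close>

lemma taylor_coeff_eq_0_imp_vanishes:
  assumes "open S" "0 \<in> S" "smooth_on S f" "\<And>i j. i + j < k \<Longrightarrow> taylor_coeff f i j = 0"
  shows "vanishes k f"
  using assms(3,4)
proof (induction k arbitrary: f)
  case (Suc k)
  have x: "vanishes k (partial_x f)"
  proof (rule Suc.IH)
    fix i j assume "i + j < k"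
    have "(partial_x ^^ i) ((partial_y ^^ j) (partial_x f)) 0
        = (partial_x ^^ i) (partial_x ((partial_y ^^ j) f)) 0"
      using Suc.prems(1) assms(1,2) partial_y_funpow_partial_x[OF assms(1) Suc.prems(1)]
      by (intro partial_x_funpow_cong[of S])
         (auto intro!: smooth_on_partial_y_funpow smooth_on_partial_x)
    also have "\<dots> = 0"
      using Suc.prems(2)[of "Suc i" j] \<open>i + j < k\<close> by (simp add: taylor_coeff_def funpow_swap1)
    finally show "taylor_coeff (partial_x f) i j = 0" by (simp add: taylor_coeff_def)
  qed (intro smooth_on_partial_x assms Suc.prems)
  have y: "vanishes k (partial_y f)"
  proof (rule Suc.IH)
    fix i j assume "i + j < k"
    then show "taylor_coeff (partial_y f) i j = 0"
      using Suc.prems(2)[of i "Suc j"] by (simp add: taylor_coeff_def funpow_swap1)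
  qed (intro smooth_on_partial_y assms Suc.prems)
  have "vanishes k (dir_deriv f v)" for v
  proof (rule vanishes_cong[OF assms(1,2)])
    have sm: "smooth_on S (partial_x f)" "smooth_on S (partial_y f)"
      using Suc.prems assms(1) by (auto intro: smooth_on_partial_x smooth_on_partial_y)
    show "smooth_on S (\<lambda>x. fst v * partial_x f x + snd v * partial_y f x)"
      by (intro smooth_on_intros sm assms)
    show "vanishes k (\<lambda>x. fst v * partial_x f x + snd v * partial_y f x)"
      using sm x y assms(1,2)
      by (intro vanishes_add[OF assms(1,2)] vanishes_linear_compose[OF bounded_linear_mult_right]
          smooth_on_mult smooth_on_const) auto
    show "fst v * partial_x f x + snd v * partial_y f x = dir_deriv f v x" if "x \<in> S" for x
      using that Suc.prems by (intro dir_deriv_eq_partials[symmetric] smooth_on_differentiable)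
  qed
  moreover have "f 0 = 0" using Suc.prems(2)[of 0 0] by (simp add: taylor_coeff_def)
  ultimately show ?case by simp
qed simp

lemma germ_order_ge_iff:
  "enat k \<le> germ_order f \<longleftrightarrow> (\<forall>i j. i + j < k \<longrightarrow> taylor_coeff f i j = 0)"
proof -
  have "enat k \<le> germ_order f \<longleftrightarrow> (\<forall>i j. taylor_coeff f i j \<noteq> 0 \<longrightarrow> k \<le> i + j)"
    unfolding germ_order_def le_Inf_iff by (auto; metis enat_ord_simps(1))
  then show ?thesis by (metis not_less)
qed

text \<open>Although only the value at 0 matters in the end, the inductions run over all points of
  \<open>S\<close>, because each further partial derivative depends on the values nearby.\<close>

lemma taylor_coeff_diff:
  assumes "open S" "0 \<in> S" "smooth_on S f" "smooth_on S g"
  shows "taylor_coeff (\<lambda>p. f p - g p) i j = taylor_coeff f i j - taylor_coeff g i j"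
proof -
  have y: "(partial_y ^^ j) (\<lambda>p. f p - g p) p = (partial_y ^^ j) f p - (partial_y ^^ j) g p"
    if "p \<in> S" for p j
    using that
  proof (induction j arbitrary: p)
    case (Suc j)
    let ?f = "(partial_y ^^ j) f" and ?g = "(partial_y ^^ j) g"
    have sm: "smooth_on S ?f" "smooth_on S ?g" by (intro smooth_on_partial_y_funpow assms)+
    have "partial_y ((partial_y ^^ j) (\<lambda>p. f p - g p)) p = partial_y (\<lambda>p. ?f p - ?g p) p"
      using Suc assms by (intro partial_y_cong[of S]) (auto intro!: smooth_on_partial_y_funpow smooth_on_diff)
    also have "\<dots> = dir_deriv (\<lambda>p. ?f p - ?g p) (0, 1) p"
      using Suc.prems sm assms(1) by (intro partial_y_eq_dir_deriv smooth_on_differentiable[of S] smooth_on_diff)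
    also have "\<dots> = dir_deriv ?f (0, 1) p - dir_deriv ?g (0, 1) p"
      using Suc.prems sm
      by (intro dir_deriv_eq has_derivative_diff has_derivative_dir_deriv smooth_on_differentiable[of S])
    finally show ?case
      using smooth_on_differentiable[OF sm(1) Suc.prems] smooth_on_differentiable[OF sm(2) Suc.prems]
      by (simp add: partial_y_eq_dir_deriv)
  qed simp
  let ?F = "(partial_y ^^ j) f" and ?G = "(partial_y ^^ j) g"
  have smy: "smooth_on S ?F" "smooth_on S ?G" by (intro smooth_on_partial_y_funpow assms)+
  have x: "(partial_x ^^ i) (\<lambda>p. ?F p - ?G p) p = (partial_x ^^ i) ?F p - (partial_x ^^ i) ?G p"
    if "p \<in> S" for p i
    using that
  proof (induction i arbitrary: p)
    case (Suc i)
    let ?f = "(partial_x ^^ i) ?F" and ?g = "(partial_x ^^ i) ?G"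
    have sm: "smooth_on S ?f" "smooth_on S ?g" by (intro smooth_on_partial_x_funpow smy assms)+
    have "partial_x ((partial_x ^^ i) (\<lambda>p. ?F p - ?G p)) p = partial_x (\<lambda>p. ?f p - ?g p) p"
      using Suc assms smy
      by (intro partial_x_cong[of S]) (auto intro!: smooth_on_partial_x_funpow smooth_on_diff)
    also have "\<dots> = dir_deriv (\<lambda>p. ?f p - ?g p) (1, 0) p"
      using Suc.prems sm assms(1) by (intro partial_x_eq_dir_deriv smooth_on_differentiable[of S] smooth_on_diff)
    also have "\<dots> = dir_deriv ?f (1, 0) p - dir_deriv ?g (1, 0) p"
      using Suc.prems sm
      by (intro dir_deriv_eq has_derivative_diff has_derivative_dir_deriv smooth_on_differentiable[of S])
    finally show ?case
      using smooth_on_differentiable[OF sm(1) Suc.prems] smooth_on_differentiable[OF sm(2) Suc.prems]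
      by (simp add: partial_x_eq_dir_deriv)
  qed simp
  have "(partial_x ^^ i) ((partial_y ^^ j) (\<lambda>p. f p - g p)) 0 = (partial_x ^^ i) (\<lambda>p. ?F p - ?G p) 0"
    using y assms
    by (intro partial_x_funpow_cong[of S]) (auto intro!: smooth_on_partial_y_funpow smooth_on_diff)
  then show ?thesis using x[OF assms(2)] by (simp add: taylor_coeff_def diff_divide_distrib)
qed

lemma jet_eqI:
  assumes "open S" "0 \<in> S" "smooth_on S f" "smooth_on S g" "vanishes (Suc k) (\<lambda>p. f p - g p)"
  shows "jet k f = jet k g"
  using vanishes_imp_taylor_coeff_eq_0[OF assms(1,2) smooth_on_diff[OF assms(1,3,4)] assms(5)]
    taylor_coeff_diff[OF assms(1-4)]
  by (auto simp: jet_def intro!: ext)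

subsection \<open>Diffeomorphism-germs of the plane\<close>

text \<open>Cramer's rule for \<open>s a + t b = w\<close>. A rational formula makes visible that
  the inverse of the derivative depends smoothly on the point.\<close>

definition cramer_solution :: "real \<times> real \<Rightarrow> real \<times> real \<Rightarrow> real \<times> real \<Rightarrow> real \<times> real" where
  "cramer_solution a b w = (let d = inverse (fst a * snd b - snd a * fst b) in
     ((fst w * snd b - snd w * fst b) * d, (fst a * snd w - snd a * fst w) * d))"

text \<open>If the determinant vanished, the second row of the matrix, turned by a right angle,
  would lie in the kernel and so be zero. Then the same holds for the first row, and
  \<open>L (1, 0) = 0\<close> contradicts injectivity.\<close>

lemma linear_plane_det_nonzero:
  fixes L :: "real \<times> real \<Rightarrow> real \<times> real"
  assumes "linear L" "inj L"
  shows "fst (L (1, 0)) * snd (L (0, 1)) - snd (L (1, 0)) * fst (L (0, 1)) \<noteq> 0"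
proof
  assume det: "fst (L (1, 0)) * snd (L (0, 1)) - snd (L (1, 0)) * fst (L (0, 1)) = 0"
  have L: "L (s, t) = s *\<^sub>R L (1, 0) + t *\<^sub>R L (0, 1)" for s t
    by (simp flip: linear_scale[OF assms(1)] linear_add[OF assms(1)])
  have ker: "p = 0" if "L p = 0" for p
    using linear_injective_0[OF assms(1)] assms(2) that by blast
  have "L (snd (L (0, 1)), - snd (L (1, 0))) = 0"
    by (subst L) (use det in \<open>simp add: prod_eq_iff algebra_simps\<close>)
  from ker[OF this] have s: "snd (L (0, 1)) = 0" "snd (L (1, 0)) = 0" by (simp_all add: zero_prod_def)
  have "L (fst (L (0, 1)), - fst (L (1, 0))) = 0"
    by (subst L) (use s in \<open>simp add: prod_eq_iff algebra_simps\<close>)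
  from ker[OF this] have "L (1, 0) = 0" using s by (simp add: zero_prod_def prod_eq_iff)
  from ker[OF this] show False by (simp add: zero_prod_def)
qed

lemma inv_linear_plane:
  fixes L :: "real \<times> real \<Rightarrow> real \<times> real"
  assumes "linear L" "inj L"
  shows "inv L w = cramer_solution (L (1, 0)) (L (0, 1)) w"
proof (rule inv_f_eq[OF assms(2)])
  have L: "L (s, t) = s *\<^sub>R L (1, 0) + t *\<^sub>R L (0, 1)" for s t
    by (simp flip: linear_scale[OF assms(1)] linear_add[OF assms(1)])
  define d where "d = inverse (fst (L (1, 0)) * snd (L (0, 1)) - snd (L (1, 0)) * fst (L (0, 1)))"
  define s where "s = (fst w * snd (L (0, 1)) - snd w * fst (L (0, 1))) * d"
  define t where "t = (fst (L (1, 0)) * snd w - snd (L (1, 0)) * fst w) * d"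
  have d: "(fst (L (1, 0)) * snd (L (0, 1)) - snd (L (1, 0)) * fst (L (0, 1))) * d = 1"
    using linear_plane_det_nonzero[OF assms] by (simp add: d_def)
  have "s * fst (L (1, 0)) + t * fst (L (0, 1)) = fst w" "s * snd (L (1, 0)) + t * snd (L (0, 1)) = snd w"
    using d unfolding s_def t_def by algebra+
  then have "L (s, t) = w" using L[of s t] by (simp add: prod_eq_iff)
  then show "L (cramer_solution (L (1, 0)) (L (0, 1)) w) = w"
    by (simp add: cramer_solution_def Let_def s_def t_def d_def)
qed

lemma smooth_on_cramer_solution:
  assumes "open S" "smooth_on S a" "smooth_on S b"
    "\<And>x. x \<in> S \<Longrightarrow> fst (a x) * snd (b x) - snd (a x) * fst (b x) \<noteq> 0"
  shows "smooth_on S (\<lambda>x. cramer_solution (a x) (b x) w)"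
  unfolding cramer_solution_def Let_def
  by (intro smooth_on_intros smooth_on_inverse assms)

text \<open>Bootstrapping: the derivative of \<open>\<sigma>\<close> in direction \<open>v\<close>
  is \<open>?G v\<close> composed with \<open>\<sigma>\<close>, and \<open>?G v\<close> is smooth by
  Cramer's rule. Hence \<open>\<sigma>\<close> of class \<open>k\<close> has derivatives of class
  \<open>k\<close>, and so is of class \<open>Suc k\<close>.\<close>

lemma inverse_smooth_plane_map:
  fixes \<tau> \<sigma> :: "real \<times> real \<Rightarrow> real \<times> real"
  assumes "open U" "open V" "homeomorphism U V \<tau> \<sigma>" "smooth_on U \<tau>"
    and der: "\<And>y. y \<in> V \<Longrightarrow> (\<sigma> has_derivative inv (\<lambda>v. dir_deriv \<tau> v (\<sigma> y))) (at y)"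
    and inj: "\<And>x. x \<in> U \<Longrightarrow> inj (\<lambda>v. dir_deriv \<tau> v x)"
  shows "smooth_on V \<sigma>"
proof -
  let ?G = "\<lambda>v x. cramer_solution (dir_deriv \<tau> (1, 0) x) (dir_deriv \<tau> (0, 1) x) v"
  have \<sigma>V: "\<sigma> ` V = U" using assms(3) by (simp add: homeomorphism_def)
  have lin: "linear (\<lambda>v. dir_deriv \<tau> v x)" if "x \<in> U" for x
    using smooth_on_differentiable[OF assms(4) that] by (rule linear_frechet_derivative)
  have G: "smooth_on U (?G v)" for v
    by (rule smooth_on_cramer_solution[OF assms(1) smooth_on_dir_deriv smooth_on_dir_deriv])
      (use assms(4) linear_plane_det_nonzero[OF lin inj] in blast)+
  have D: "?G v (\<sigma> y) = dir_deriv \<sigma> v y" if "y \<in> V" for v y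
  proof -
    have "\<sigma> y \<in> U" using \<sigma>V that by blast
    from inv_linear_plane[OF lin[OF this] inj[OF this], of v] dir_deriv_eq[OF der[OF that], of v]
    show ?thesis by simp
  qed
  have "Ck_on k V \<sigma>" for k
  proof (induction k)
    case 0
    then show ?case using assms(3) by (simp add: homeomorphism_def)
  next
    case (Suc k)
    have "Ck_on k V (dir_deriv \<sigma> v)" for v
    proof (rule Ck_on_cong[OF assms(2) D])
      show "Ck_on k V (\<lambda>y. ?G v (\<sigma> y))"
      proof (rule Ck_on_compose[OF assms(2) _ Suc])
        show "Ck_on k U (?G v)" using G[of v] unfolding smooth_on_def by blast
        show "\<sigma> ` V \<subseteq> U" using \<sigma>V by blast
      qed
    qed
    moreover have "\<sigma> differentiable (at y)" if "y \<in> V" for y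
      using der[OF that] unfolding differentiable_def by blast
    ultimately show ?case by simp
  qed
  then show ?thesis by (simp add: smooth_on_def)
qed

text \<open>The inverse function theorem gives a local inverse with its first derivative; smoothness
  of that inverse is the preceding lemma. The theorem takes the derivative as a continuous map into
  bounded linear maps, hence \<open>F\<close>, whose continuity is checked componentwise, and a left
  inverse of \<open>F 0\<close>.\<close>

theorem diffeo_germI:
  fixes \<tau> :: "real \<times> real \<Rightarrow> real \<times> real"
  assumes "open S" "0 \<in> S" "smooth_on S \<tau>" "\<tau> 0 = 0" "inj (\<lambda>v. dir_deriv \<tau> v 0)"
  shows "diffeo_germ \<tau>"
proof -
  define F where "F x = Blinfun (\<lambda>v. dir_deriv \<tau> v x)" for x
  have diff: "\<tau> differentiable (at x)" if "x \<in> S" for x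
    using smooth_on_differentiable[OF assms(3) that] .
  have F: "blinfun_apply (F x) = (\<lambda>v. dir_deriv \<tau> v x)" if "x \<in> S" for x
    unfolding F_def
    by (rule bounded_linear_Blinfun_apply)
       (rule has_derivative_bounded_linear[OF has_derivative_dir_deriv[OF diff[OF that]]])
  have cont: "continuous_on S F"
  proof (rule continuous_on_blinfun_componentwise)
    show "continuous_on S (\<lambda>x. blinfun_apply (F x) i)" for i
      using smooth_on_continuous[OF smooth_on_dir_deriv[OF assms(3), of i]] F
      by (simp cong: continuous_on_cong)
  qed
  have "linear (blinfun_apply (F 0))" by (simp add: blinfun.bounded_linear_right bounded_linear.linear)
  moreover have "inj (blinfun_apply (F 0))" using assms(2,5) F by simp
  ultimately obtain g where g: "linear g" "g \<circ> blinfun_apply (F 0) = id"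
    using linear_injective_left_inverse by blast
  have "Blinfun g o\<^sub>L F 0 = id_blinfun"
    using g(1) pointfree_idE[OF g(2)]
    by (intro blinfun_eqI) (simp add: bounded_linear_Blinfun_apply linear_conv_bounded_linear)
  then obtain U V \<sigma> g' where U: "open U" "U \<subseteq> S" "0 \<in> U" and V: "open V" "\<tau> 0 \<in> V"
    and hom: "homeomorphism U V \<tau> \<sigma>"
    and g': "\<And>y. y \<in> V \<Longrightarrow> (\<sigma> has_derivative g' y) (at y)"
      "\<And>y. y \<in> V \<Longrightarrow> g' y = inv (blinfun_apply (F (\<sigma> y)))"
      "\<And>y. y \<in> V \<Longrightarrow> bij (blinfun_apply (F (\<sigma> y)))"
    using inverse_function_theorem[OF assms(1) _ cont assms(2), of \<tau> "Blinfun g"]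
      has_derivative_dir_deriv[OF diff] F by metis
  have \<sigma>V: "\<sigma> ` V = U" using hom by (simp add: homeomorphism_def)
  have "smooth_on V \<sigma>"
  proof (rule inverse_smooth_plane_map[OF U(1) V(1) hom smooth_on_subset[OF assms(3) U(2)]])
    show "(\<sigma> has_derivative inv (\<lambda>v. dir_deriv \<tau> v (\<sigma> y))) (at y)" if "y \<in> V" for y
      using g'(1,2)[OF that] F[of "\<sigma> y"] \<sigma>V U(2) that by auto
    show "inj (\<lambda>v. dir_deriv \<tau> v x)" if x: "x \<in> U" for x
    proof -
      obtain y where "y \<in> V" "x = \<sigma> y" using x \<sigma>V by blast
      then show ?thesis using g'(3)[of y] F[of x] U(2) x by (auto simp: bij_def)
    qed
  qed
  then show ?thesis
    unfolding diffeo_germ_def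
    using assms(4) U V hom smooth_on_subset[OF assms(3) U(2)] by auto
qed

section \<open>Composition of germs with diffeomorphism-germs\<close>

lemma diffeo_germ_compose_nhd:
  assumes "function_germ f" "diffeo_germ \<tau>"
  obtains W U where "open W" "0 \<in> W" "smooth_on W \<tau>" "\<tau> 0 = 0" "\<tau> ` W \<subseteq> U" "smooth_on U f"
    "smooth_on W (\<lambda>p. f (\<tau> p))"
proof -
  obtain U where U: "open U" "0 \<in> U" "smooth_on U f"
    using assms(1) by (auto simp: function_germ_def)
  obtain U1 where U1: "open U1" "0 \<in> U1" "smooth_on U1 \<tau>" and 0: "\<tau> 0 = 0"
    using assms(2) by (auto simp: diffeo_germ_def)
  let ?W = "U1 \<inter> \<tau> -` U"
  have W: "open ?W"
    using continuous_open_preimage[OF smooth_on_continuous[OF U1(3)] U1(1) U(1)] .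
  have sm: "smooth_on ?W \<tau>" using smooth_on_subset[OF U1(3)] by blast
  have sub: "\<tau> ` ?W \<subseteq> U" by blast
  show ?thesis
    by (rule that[OF W _ sm 0 sub U(3) smooth_on_compose[OF W U(3) sm sub]]) (simp add: U1(2) U(2) 0)
qed

lemma function_germ_compose:
  assumes "function_germ f" "diffeo_germ \<tau>"
  shows "function_germ (\<lambda>p. f (\<tau> p))"
proof -
  obtain W where "open W" "0 \<in> W" "smooth_on W (\<lambda>p. f (\<tau> p))" "\<tau> 0 = 0"
    by (rule diffeo_germ_compose_nhd[OF assms])
  then show ?thesis using assms(1) by (auto simp: function_germ_def)
qed

lemma function_germ_add:
  assumes "function_germ f" "function_germ g"
  shows "function_germ (\<lambda>p. f p + g p)"
proof -
  obtain U V where "open U" "0 \<in> U" "smooth_on U f" "open V" "0 \<in> V" "smooth_on V g"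
    using assms by (auto simp: function_germ_def)
  then have "open (U \<inter> V)" "0 \<in> U \<inter> V" "smooth_on (U \<inter> V) f" "smooth_on (U \<inter> V) g"
    by (auto intro: smooth_on_subset[of U] smooth_on_subset[of V])
  then show ?thesis using smooth_on_add[of "U \<inter> V" f g] assms by (auto simp: function_germ_def)
qed

lemma germ_order_ge_iff_vanishes:
  assumes "function_germ f"
  shows "enat k \<le> germ_order f \<longleftrightarrow> vanishes k f"
proof -
  obtain S where S: "open S" "0 \<in> S" "smooth_on S f" using assms by (auto simp: function_germ_def)
  show ?thesis
    unfolding germ_order_ge_iff
    using vanishes_imp_taylor_coeff_eq_0[OF S] taylor_coeff_eq_0_imp_vanishes[OF S] by blast
qed

lemma vanishes_compose_diffeo_germ:
  assumes "function_germ f" "diffeo_germ \<tau>" "vanishes k f"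
  shows "vanishes k (\<lambda>p. f (\<tau> p))"
proof -
  obtain W U where W: "open W" "0 \<in> W" "smooth_on W \<tau>" "\<tau> 0 = 0" "\<tau> ` W \<subseteq> U" "smooth_on U f"
    by (rule diffeo_germ_compose_nhd[OF assms(1,2)])
  show ?thesis by (rule vanishes_compose[OF W(1,2,6,3,5,4) assms(3)])
qed

text \<open>The intermediate germ in the definition is taken to be \<open>f\<close> composed with
  \<open>\<tau>\<close>: it is right-equivalent to \<open>f\<close> by construction, and its
  \<open>k\<close>-jet is that of \<open>h\<close> because the difference has order above
  \<open>k\<close>.\<close>

lemma R_equivalentI:
  assumes "function_germ f" "diffeo_germ \<tau>" "smooth_on UNIV h"
    "vanishes (Suc k) (\<lambda>p. f (\<tau> p) - h p)"
  shows "R_equivalent k f h"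
proof -
  let ?g = "\<lambda>p. f (\<tau> p)"
  have germ: "function_germ ?g" by (rule function_germ_compose[OF assms(1,2)])
  then obtain W where "open W" "0 \<in> W" "smooth_on W ?g" by (auto simp: function_germ_def)
  then have "jet k ?g = jet k h"
    using jet_eqI[OF _ _ _ _ assms(4)] smooth_on_subset[OF assms(3)] by blast
  moreover have "right_equivalent f ?g"
    using assms(2) by (auto simp: right_equivalent_def right_equivalent_by_def)
  ultimately show ?thesis using germ by (auto simp: R_equivalent_def)
qed

text \<open>Order 2 means zero value and zero derivative at the origin, so the map has the identity
  as its derivative there.\<close>

lemma diffeo_germ_near_identity:
  assumes "smooth_on UNIV u" "smooth_on UNIV v" "vanishes 2 u" "vanishes 2 v"
  shows "diffeo_germ (\<lambda>p. (fst p + u p, snd p + v p))"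
proof (rule diffeo_germI)
  let ?\<tau> = "\<lambda>p. (fst p + u p, snd p + v p)"
  show "smooth_on UNIV ?\<tau>" using assms by (intro smooth_on_intros) auto
  show "?\<tau> 0 = 0" using assms(3,4) by (simp add: numeral_2_eq_2 zero_prod_def)
  have d: "u differentiable (at 0)" "v differentiable (at 0)"
    using assms(1,2) by (auto intro: smooth_on_differentiable)
  have "dir_deriv ?\<tau> w 0 = w" for w
  proof -
    have "(?\<tau> has_derivative (\<lambda>w. (fst w + dir_deriv u w 0, snd w + dir_deriv v w 0))) (at 0)"
      using d by (intro has_derivative_Pair has_derivative_add has_derivative_fst has_derivative_snd
          has_derivative_ident has_derivative_dir_deriv)
    from dir_deriv_eq[OF this, of w] show ?thesis
      using assms(3,4) by (simp add: numeral_2_eq_2 del: split_paired_All)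
  qed
  then show "inj (\<lambda>w. dir_deriv ?\<tau> w 0)" by (simp add: inj_on_def)
qed auto

subsection \<open>Homogeneous polynomials and the tangent space of the orbit\<close>

text \<open>The index \<open>i\<close> is the exponent of \<open>y\<close>, and entries of
  \<open>a\<close> beyond \<open>n\<close> are not read. Naming the form by its coefficients turns
  differentiation into operations on sequences.\<close>

definition hpoly :: "nat \<Rightarrow> (nat \<Rightarrow> real) \<Rightarrow> real \<times> real \<Rightarrow> real" where
  "hpoly n a = (\<lambda>(x, y). \<Sum>i\<le>n. a i * x ^ (n - i) * y ^ i)"

text \<open>The derivative of \<open>g7\<close> along the vector field with components \<open>hpoly d u\<close>, \<open>hpoly d v\<close>.\<close>

definition tangent :: "nat \<Rightarrow> (nat \<Rightarrow> real) \<Rightarrow> (nat \<Rightarrow> real) \<Rightarrow> real \<times> real \<Rightarrow> real" where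
  "tangent d u v p = 7 * Im (Complex (fst p) (snd p) ^ 6 * Complex (hpoly d u p) (hpoly d v p))"

lemma tangent_eq:
  "tangent d u v (x, y) = 7 * ((6 * x ^ 5 * y - 20 * x ^ 3 * y ^ 3 + 6 * x * y ^ 5) * hpoly d u (x, y)
     + (x ^ 6 - 15 * x ^ 4 * y ^ 2 + 15 * x ^ 2 * y ^ 4 - y ^ 6) * hpoly d v (x, y))"
  by (simp add: tangent_def numeral_eq_Suc algebra_simps)

text \<open>The coefficients below are the unique solution of a square linear system: comparing coefficients
  gives \<open>n + 1\<close> equations, and the unknowns are \<open>u\<close>, \<open>v\<close> and the coefficients on the right-hand side.\<close>

lemma normal_form_8:
  "\<exists>u v. \<forall>x y. hpoly 8 a (x, y) + tangent 2 u v (x, y)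
    = ((35 * a 0 - 3 * a 4 - 10 * a 6 - 105 * a 8) / 35) * x ^ 8
      + ((7 * a 1 + 3 * a 3 + 3 * a 5 + 7 * a 7) / 7) * x ^ 7 * y
      + ((5 * a 2 + 6 * a 4 + 15 * a 6 + 140 * a 8) / 5) * x ^ 6 * y ^ 2"
proof (intro exI allI)
  fix x y
  \<comment> \<open>Only indices up to 2 are read, so lists of length 3 suffice.
    \<open>Im z^6\<close> is odd and \<open>Re z^6\<close> is even in \<open>y\<close>, so the
    system splits by the parity of the exponent of \<open>y\<close>: each entry involves only even
    or only odd indices of \<open>a\<close>. The last entry of \<open>?v\<close> can be read off at
    \<open>y^8\<close>, where \<open>tangent\<close> contributes -7 times that entry.\<close>
  let ?u = "(!) [(5 * a 3 + 6 * a 5 + 15 * a 7) / 448,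
      (- a 4 - 15 * a 6 - 210 * a 8) / 490,
      (- 3 * a 3 - 10 * a 5 - 105 * a 7) / 3136]"
  let ?v = "(!) [(- 3 * a 4 - 10 * a 6 - 105 * a 8) / 245,
      (- 9 * a 3 - 30 * a 5 - 91 * a 7) / 1568,
      (a 8) / 7]"
  show "hpoly 8 a (x, y) + tangent 2 ?u ?v (x, y)
    = ((35 * a 0 - 3 * a 4 - 10 * a 6 - 105 * a 8) / 35) * x ^ 8
      + ((7 * a 1 + 3 * a 3 + 3 * a 5 + 7 * a 7) / 7) * x ^ 7 * y
      + ((5 * a 2 + 6 * a 4 + 15 * a 6 + 140 * a 8) / 5) * x ^ 6 * y ^ 2"
    unfolding tangent_eq hpoly_def
    by (simp add: atMost_nat_numeral atMost_Suc power_numeral_reduce algebra_simps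
        add_divide_distrib diff_divide_distrib)
qed

lemma normal_form_9:
  "\<exists>u v. \<forall>x y. hpoly 9 a (x, y) + tangent 3 u v (x, y)
    = ((63 * a 0 + 7 * a 2 + 3 * a 4 + 3 * a 6 + 7 * a 8) / 63) * x ^ 9
      + ((7 * a 1 + 3 * a 3 + 3 * a 5 + 7 * a 7 + 63 * a 9) / 7) * x ^ 8 * y"
proof (intro exI allI)
  fix x y
  let ?u = "(!) [(5 * a 3 + 6 * a 5 + 15 * a 7 + 140 * a 9) / 448,
      (161 * a 2 + 174 * a 4 + 195 * a 6 + 476 * a 8) / 9408,
      (- 3 * a 3 - 10 * a 5 - 105 * a 7 - 1428 * a 9) / 3136,
      (- 5 * a 2 - 6 * a 4 - 15 * a 6 - 140 * a 8) / 4032]"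
  let ?v = "(!) [(7 * a 2 + 3 * a 4 + 3 * a 6 + 7 * a 8) / 441,
      (- 9 * a 3 - 30 * a 5 - 91 * a 7 - 924 * a 9) / 1568,
      (- 5 * a 2 - 6 * a 4 - 15 * a 6 - 44 * a 8) / 672,
      (a 9) / 7]"
  show "hpoly 9 a (x, y) + tangent 3 ?u ?v (x, y)
    = ((63 * a 0 + 7 * a 2 + 3 * a 4 + 3 * a 6 + 7 * a 8) / 63) * x ^ 9
      + ((7 * a 1 + 3 * a 3 + 3 * a 5 + 7 * a 7 + 63 * a 9) / 7) * x ^ 8 * y"
    unfolding tangent_eq hpoly_def
    by (simp add: atMost_nat_numeral atMost_Suc power_numeral_reduce algebra_simps
        add_divide_distrib diff_divide_distrib)
qed

lemma normal_form_10:
  "\<exists>u v. \<forall>x y. hpoly 10 a (x, y) + tangent 4 u v (x, y)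
    = ((63 * a 0 + 7 * a 2 + 3 * a 4 + 3 * a 6 + 7 * a 8 + 63 * a 10) / 63) * x ^ 10"
proof (intro exI allI)
  fix x y
  let ?u = "(!) [(- 63 * a 1 - 7 * a 3 - 3 * a 5 - 3 * a 7 - 7 * a 9) / 1792,
      (161 * a 2 + 174 * a 4 + 195 * a 6 + 476 * a 8 + 4389 * a 10) / 9408,
      (51 * a 1 + 21 * a 3 + 19 * a 5 + 21 * a 7 + 51 * a 9) / 896,
      (- 5 * a 2 - 6 * a 4 - 15 * a 6 - 140 * a 8 - 1881 * a 10) / 4032,
      (- 7 * a 1 - 3 * a 3 - 3 * a 5 - 7 * a 7 - 63 * a 9) / 1792]"
  let ?v = "(!) [(7 * a 2 + 3 * a 4 + 3 * a 6 + 7 * a 8 + 63 * a 10) / 441,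
      (61 * a 1 + 21 * a 3 + 9 * a 5 + 9 * a 7 + 21 * a 9) / 896,
      (- 5 * a 2 - 6 * a 4 - 15 * a 6 - 44 * a 8 - 441 * a 10) / 672,
      (- 21 * a 1 - 9 * a 3 - 9 * a 5 - 21 * a 7 - 61 * a 9) / 896,
      (a 10) / 7]"
  show "hpoly 10 a (x, y) + tangent 4 ?u ?v (x, y)
    = ((63 * a 0 + 7 * a 2 + 3 * a 4 + 3 * a 6 + 7 * a 8 + 63 * a 10) / 63) * x ^ 10"
    unfolding tangent_eq hpoly_def
    by (simp add: atMost_nat_numeral atMost_Suc power_numeral_reduce algebra_simps
        add_divide_distrib diff_divide_distrib)
qed

section \<open>Differentiation on coefficients\<close>

lemma homogeneous_poly_iff: "homogeneous_poly n f \<longleftrightarrow> (\<exists>a. f = hpoly n a)"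
  by (auto simp: homogeneous_poly_def hpoly_def fun_eq_iff)

lemma hpoly_eq: "hpoly n a p = (\<Sum>i\<le>n. a i * (fst p ^ (n - i) * snd p ^ i))"
  by (cases p) (simp add: hpoly_def mult.assoc)

lemma hpoly_0: "hpoly 0 a p = a 0"
  by (simp add: hpoly_eq)

lemma partial_x_hpoly: "partial_x (hpoly (Suc n) a) = hpoly n (\<lambda>i. real (Suc n - i) * a i)"
proof -
  have "((\<lambda>t. hpoly (Suc n) a (t, y)) has_field_derivative hpoly n (\<lambda>i. real (Suc n - i) * a i) (x, y)) (at x)"
    for x y
    unfolding hpoly_def case_prod_conv
    by (rule derivative_eq_intros | rule refl)+
       (auto intro!: sum.cong simp: ac_simps)
  then show ?thesis by (auto simp: partial_x_def fun_eq_iff intro: DERIV_imp_deriv)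
qed

lemma partial_y_hpoly: "partial_y (hpoly (Suc n) a) = hpoly n (\<lambda>i. real (Suc i) * a (Suc i))"
proof -
  have "((\<lambda>t. hpoly (Suc n) a (x, t)) has_field_derivative hpoly n (\<lambda>i. real (Suc i) * a (Suc i)) (x, y)) (at y)"
    for x y
    \<comment> \<open>The term with index 0 is constant in \<open>y\<close>. Splitting it off aligns
      the remaining terms with the shifted coefficients of the derivative.\<close>
    unfolding hpoly_def case_prod_conv sum.atMost_Suc_shift
    by (rule derivative_eq_intros | rule refl)+
       (auto intro!: sum.cong simp: ac_simps)
  then show ?thesis by (auto simp: partial_y_def fun_eq_iff intro: DERIV_imp_deriv)
qed

text \<open>The bracketing is what two uses each of \<open>partial_x_hpoly\<close> and
  \<open>partial_y_hpoly\<close> produce, so that \<open>laplacian_hpoly\<close> holds by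
  unfolding.\<close>

definition laplacian_coeffs :: "nat \<Rightarrow> (nat \<Rightarrow> real) \<Rightarrow> nat \<Rightarrow> real" where
  "laplacian_coeffs n a i = real (Suc n - i) * (real (Suc (Suc n) - i) * a i)
     + real (Suc i) * (real (Suc (Suc i)) * a (Suc (Suc i)))"

lemma hpoly_add: "hpoly n a p + hpoly n b p = hpoly n (\<lambda>i. a i + b i) p"
  by (simp add: hpoly_eq sum.distrib distrib_right)

lemma laplacian_hpoly: "laplacian (hpoly (Suc (Suc n)) a) = hpoly n (laplacian_coeffs n a)"
  unfolding laplacian_def partial_x_hpoly partial_y_hpoly hpoly_add laplacian_coeffs_def[abs_def] ..

lemma hpoly_eq_0_imp:
  assumes "\<And>p. hpoly n a p = 0" "i \<le> n"
  shows "a i = 0"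
proof -
  \<comment> \<open>Setting \<open>x = 1\<close> reduces the claim to polynomials in one
    variable.\<close>
  have "(\<Sum>i\<le>n. a i * y ^ i) = 0" for y
    using assms(1)[of "(1, y)"] by (simp add: hpoly_def)
  then show ?thesis using polyfun_eq_0[of a n] assms(2) by blast
qed

lemma smooth_on_hpoly: "smooth_on UNIV (hpoly n a)"
  unfolding hpoly_eq[abs_def] by (intro smooth_on_intros open_UNIV)

section \<open>Orders of the errors made by a perturbation of the identity\<close>

lemma vanishes_fst: "vanishes 1 (fst :: real \<times> real \<Rightarrow> real)"
  and vanishes_snd: "vanishes 1 (snd :: real \<times> real \<Rightarrow> real)"
  by simp_all

lemma smooth_on_fst': "smooth_on S (fst :: real \<times> real \<Rightarrow> real)"
  and smooth_on_snd': "smooth_on S (snd :: real \<times> real \<Rightarrow> real)"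
  by (rule smooth_on_bounded_linear[OF bounded_linear_fst] smooth_on_bounded_linear[OF bounded_linear_snd])+

text \<open>Write \<open>f g - f' g' = (f - f') g + f' (g - g')\<close>. The number \<open>e\<close>
  measures by how much the agreement exceeds the order of the functions themselves, and it is
  preserved by products.\<close>

lemma vanishes_mult_diff:
  fixes f f' g g' :: "'a::real_normed_vector \<Rightarrow> 'b::real_normed_algebra"
  assumes "open S" "0 \<in> S"
    and "smooth_on S f" "smooth_on S f'" "smooth_on S g" "smooth_on S g'"
    and "vanishes k f'" "vanishes l g"
    and "vanishes (k + e) (\<lambda>x. f x - f' x)" "vanishes (l + e) (\<lambda>x. g x - g' x)"
  shows "vanishes (k + l + e) (\<lambda>x. f x * g x - f' x * g' x)"
proof -
  have "vanishes (k + l + e) (\<lambda>x. (f x - f' x) * g x + f' x * (g x - g' x))"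
  proof (rule vanishes_add[OF assms(1,2)])
    show "smooth_on S (\<lambda>x. (f x - f' x) * g x)" "smooth_on S (\<lambda>x. f' x * (g x - g' x))"
      by (intro smooth_on_mult smooth_on_diff assms)+
    show "vanishes (k + l + e) (\<lambda>x. (f x - f' x) * g x)"
      by (rule vanishes_mult[OF assms(1,2) smooth_on_diff[OF assms(1,3,4)] assms(5,9,8)]) simp
    show "vanishes (k + l + e) (\<lambda>x. f' x * (g x - g' x))"
      by (rule vanishes_mult[OF assms(1,2,4) smooth_on_diff[OF assms(1,5,6)] assms(7,10)]) simp
  qed
  then show ?thesis by (simp add: algebra_simps)
qed

lemma vanishes_power_diff:
  fixes f f' :: "'a::real_normed_vector \<Rightarrow> 'b::real_normed_field"
  assumes "open S" "0 \<in> S" "smooth_on S f" "smooth_on S f'"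
    and "vanishes 1 f" "vanishes 1 f'" "vanishes (1 + e) (\<lambda>x. f x - f' x)"
  shows "vanishes (n + e) (\<lambda>x. f x ^ n - f' x ^ n)"
proof (induction n)
  case 0
  then show ?case by (simp add: vanishes_zero)
next
  case (Suc n)
  have "vanishes (n * 1) (\<lambda>x. f x ^ n)" by (rule vanishes_power[OF assms(1,2,3,5)])
  then show ?case
    using vanishes_mult_diff[OF assms(1-4) smooth_on_power[OF assms(1,3)] smooth_on_power[OF assms(1,4)]
        assms(6) _ assms(7) Suc]
    by simp
qed

lemma vanishes_hpoly: "vanishes n (hpoly n a)"
  unfolding hpoly_eq[abs_def]
proof (rule vanishes_sum[OF open_UNIV UNIV_I])
  fix i assume i: "i \<in> {..n}"
  have sm: "smooth_on UNIV (\<lambda>p::real \<times> real. fst p ^ (n - i))" "smooth_on UNIV (\<lambda>p::real \<times> real. snd p ^ i)"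
    by (intro smooth_on_intros open_UNIV)+
  have "vanishes ((n - i) * 1) (\<lambda>p::real \<times> real. fst p ^ (n - i))"
    by (rule vanishes_power[OF open_UNIV UNIV_I smooth_on_fst' vanishes_fst])
  moreover have "vanishes (i * 1) (\<lambda>p::real \<times> real. snd p ^ i)"
    by (rule vanishes_power[OF open_UNIV UNIV_I smooth_on_snd' vanishes_snd])
  ultimately have "vanishes n (\<lambda>p. fst p ^ (n - i) * snd p ^ i :: real)"
    by (rule vanishes_mult[OF open_UNIV UNIV_I sm]) (use i in simp)
  then show "vanishes n (\<lambda>p. a i * (fst p ^ (n - i) * snd p ^ i))"
    by (rule vanishes_linear_compose[OF bounded_linear_mult_right open_UNIV UNIV_I smooth_on_mult[OF open_UNIV sm]])
  show "smooth_on UNIV (\<lambda>p. a i * (fst p ^ (n - i) * snd p ^ i))"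
    by (intro smooth_on_intros open_UNIV)
qed

text \<open>Each monomial is a product of powers of the two coordinates, and a coordinate changes by
  a term of order \<open>1 + e\<close>; the gain \<open>e\<close> over the degree passes through
  powers and products. This is why forms of degree at least 8 survive the coordinate change up to
  the degree of interest.\<close>

lemma vanishes_hpoly_perturbed:
  assumes "smooth_on UNIV u" "smooth_on UNIV v" "vanishes (Suc e) u" "vanishes (Suc e) v"
  shows "vanishes (n + e) (\<lambda>p. hpoly n a (fst p + u p, snd p + v p) - hpoly n a p)"
proof -
  have sm: "smooth_on UNIV (\<lambda>p. fst p + u p)" "smooth_on UNIV (\<lambda>p. snd p + v p)"
    by (intro smooth_on_intros open_UNIV assms)+
  have van: "vanishes 1 (\<lambda>p. fst p + u p)" "vanishes 1 (\<lambda>p. snd p + v p)"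
    using assms(3,4) by simp_all
  have dx: "vanishes (k + e) (\<lambda>p. (fst p + u p) ^ k - fst p ^ k)" for k
    by (rule vanishes_power_diff[OF open_UNIV UNIV_I sm(1) smooth_on_fst' van(1) vanishes_fst])
       (use assms(3) in simp)
  have dy: "vanishes (k + e) (\<lambda>p. (snd p + v p) ^ k - snd p ^ k)" for k
    by (rule vanishes_power_diff[OF open_UNIV UNIV_I sm(2) smooth_on_snd' van(2) vanishes_snd])
       (use assms(4) in simp)
  have mono: "vanishes (k + l + e) (\<lambda>p. (fst p + u p) ^ k * (snd p + v p) ^ l - fst p ^ k * snd p ^ l)"
    for k l
  proof (rule vanishes_mult_diff[OF open_UNIV UNIV_I])
    show "vanishes k (\<lambda>p::real \<times> real. fst p ^ k)"
      using vanishes_power[OF open_UNIV UNIV_I smooth_on_fst' vanishes_fst, of k] by simp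
    show "vanishes l (\<lambda>p. (snd p + v p) ^ l)"
      using vanishes_power[OF open_UNIV UNIV_I sm(2) van(2), of l] by simp
  qed (intro dx dy smooth_on_intros open_UNIV assms)+
  have smm: "smooth_on UNIV (\<lambda>p. (fst p + u p) ^ k * (snd p + v p) ^ l - fst p ^ k * snd p ^ l)" for k l
    by (intro smooth_on_intros open_UNIV assms)
  have "vanishes (n + e) (\<lambda>p. \<Sum>i\<le>n. a i * ((fst p + u p) ^ (n - i) * (snd p + v p) ^ i - fst p ^ (n - i) * snd p ^ i))"
  proof (rule vanishes_sum[OF open_UNIV UNIV_I])
    fix i assume "i \<in> {..n}"
    then have "vanishes (n + e) (\<lambda>p. (fst p + u p) ^ (n - i) * (snd p + v p) ^ i - fst p ^ (n - i) * snd p ^ i)"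
      using mono[of "n - i" i] by simp
    then show "vanishes (n + e) (\<lambda>p. a i * ((fst p + u p) ^ (n - i) * (snd p + v p) ^ i - fst p ^ (n - i) * snd p ^ i))"
      by (rule vanishes_linear_compose[OF bounded_linear_mult_right open_UNIV UNIV_I smm])
  qed (intro smooth_on_mult smooth_on_const open_UNIV smm)
  then show ?thesis by (simp add: hpoly_eq right_diff_distrib sum_subtractf)
qed

text \<open>Let \<open>E n\<close> be the remainder. Then
  \<open>E (n + 1) = (z + w) * E n + n * z^(n-1) * w^2\<close>, and both terms have order
  \<open>n + 1 + 2 * e\<close>. The truncated \<open>n - 1\<close> at \<open>n = 0\<close> is
  harmless, as it comes with the factor \<open>of_nat n\<close>.\<close>

lemma vanishes_power_second_order:
  fixes z w :: "'a::real_normed_vector \<Rightarrow> 'b::real_normed_field"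
  assumes "open S" "0 \<in> S" "smooth_on S z" "smooth_on S w" "vanishes 1 z" "vanishes (Suc e) w"
  shows "vanishes (n + 2 * e) (\<lambda>x. (z x + w x) ^ n - z x ^ n - of_nat n * (z x ^ (n - 1) * w x))"
proof (induction n)
  case 0
  then show ?case by (simp add: vanishes_zero)
next
  case (Suc n)
  let ?E = "\<lambda>x. (z x + w x) ^ n - z x ^ n - of_nat n * (z x ^ (n - 1) * w x)"
  have smE: "smooth_on S ?E" by (intro smooth_on_intros assms)
  have sm: "smooth_on S (\<lambda>x. z x + w x)" by (intro smooth_on_intros assms)
  have 1: "vanishes (Suc n + 2 * e) (\<lambda>x. (z x + w x) * ?E x)"
    by (rule vanishes_mult[OF assms(1,2) sm smE _ Suc, of 1]) (use assms(5,6) in simp_all)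
  have 2: "vanishes (Suc n + 2 * e) (\<lambda>x. of_nat n * (z x ^ (n - 1) * w x ^ 2))"
  proof (cases n)
    case 0
    then show ?thesis by (simp add: vanishes_zero)
  next
    case (Suc m)
    have "vanishes (m * 1) (\<lambda>x. z x ^ m)" "vanishes (2 * Suc e) (\<lambda>x. w x ^ 2)"
      by (rule vanishes_power[OF assms(1,2)], fact assms, fact assms)+
    then have "vanishes (Suc n + 2 * e) (\<lambda>x. z x ^ m * w x ^ 2)"
      by (rule vanishes_mult[OF assms(1,2) smooth_on_power[OF assms(1,3)] smooth_on_power[OF assms(1,4)]])
         (simp add: Suc)
    then have "vanishes (Suc n + 2 * e) (\<lambda>x. of_nat n * (z x ^ m * w x ^ 2))"
      by (rule vanishes_linear_compose[OF bounded_linear_mult_right assms(1,2), rotated])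
         (intro smooth_on_intros assms)
    then show ?thesis by (simp add: Suc)
  qed
  have eq: "(z x + w x) ^ Suc n - z x ^ Suc n - of_nat (Suc n) * (z x ^ (Suc n - 1) * w x)
      = (z x + w x) * ?E x + of_nat n * (z x ^ (n - 1) * w x ^ 2)" for x
    by (cases n) (simp_all add: algebra_simps power2_eq_square)
  show ?case
    unfolding eq by (rule vanishes_add[OF assms(1,2) _ _ 1 2]) (intro smooth_on_intros assms)+
qed

lemma smooth_on_Complex:
  assumes "open S" "smooth_on S f" "smooth_on S g"
  shows "smooth_on S (\<lambda>x. Complex (f x) (g x))"
  unfolding Complex_eq
  by (intro smooth_on_add smooth_on_mult smooth_on_const assms
      smooth_on_linear_compose[OF bounded_linear_of_real])

lemma vanishes_Complex:
  assumes "open S" "0 \<in> S" "smooth_on S f" "smooth_on S g" "vanishes k f" "vanishes k g"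
  shows "vanishes k (\<lambda>x. Complex (f x) (g x))"
proof -
  have "vanishes k (\<lambda>x. complex_of_real (f x))" "vanishes k (\<lambda>x. complex_of_real (g x))"
    "smooth_on S (\<lambda>x. complex_of_real (f x))" "smooth_on S (\<lambda>x. complex_of_real (g x))"
    by (rule vanishes_linear_compose[OF bounded_linear_of_real assms(1,2)]
        smooth_on_linear_compose[OF bounded_linear_of_real assms(1)], (fact assms)+)+
  then show ?thesis
    unfolding Complex_eq
    by (intro vanishes_add[OF assms(1,2)] smooth_on_mult smooth_on_const assms(1)
        vanishes_linear_compose[OF bounded_linear_mult_right assms(1,2)])
qed

lemma g7_eq: "g7 p = Im (Complex (fst p) (snd p) ^ 7)"
  by (cases p) (simp add: g7_def Complex_eq)

text \<open>In the expansion of \<open>(z + w)^7\<close> the linear term in \<open>w\<close> gives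
  \<open>tangent\<close>, and the first neglected term \<open>z^5 w^2\<close> has order
  \<open>5 + 2 * (e + 1)\<close>.\<close>

lemma vanishes_g7_perturbed:
  assumes "Suc e = d"
  shows "vanishes (7 + 2 * e)
    (\<lambda>p. g7 (fst p + hpoly d u p, snd p + hpoly d v p) - g7 p - tangent d u v p)"
proof -
  let ?z = "\<lambda>p. Complex (fst p) (snd p)" and ?w = "\<lambda>p. Complex (hpoly d u p) (hpoly d v p)"
  have sm: "smooth_on UNIV ?z" "smooth_on UNIV ?w"
    by (intro smooth_on_Complex smooth_on_fst' smooth_on_snd' smooth_on_hpoly open_UNIV)+
  have z: "vanishes 1 ?z" by (simp add: zero_complex.code)
  have w: "vanishes (Suc e) ?w"
    unfolding assms by (intro vanishes_Complex[OF open_UNIV UNIV_I] smooth_on_hpoly vanishes_hpoly)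
  have "vanishes (7 + 2 * e) (\<lambda>p. Im ((?z p + ?w p) ^ 7 - ?z p ^ 7 - of_nat 7 * (?z p ^ (7 - 1) * ?w p)))"
    by (rule vanishes_linear_compose[OF bounded_linear_Im open_UNIV UNIV_I _
          vanishes_power_second_order[OF open_UNIV UNIV_I sm z w]])
       (intro smooth_on_intros open_UNIV sm)
  moreover have "Im ((?z p + ?w p) ^ 7 - ?z p ^ 7 - of_nat 7 * (?z p ^ (7 - 1) * ?w p))
      = g7 (fst p + hpoly d u p, snd p + hpoly d v p) - g7 p - tangent d u v p" for p
  proof -
    have "Complex (fst p + hpoly d u p) (snd p + hpoly d v p) = ?z p + ?w p"
      by (simp add: complex_eq_iff)
    then show ?thesis by (simp add: g7_eq tangent_def)
  qed
  ultimately show ?thesis by simp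
qed

lemma smooth_on_g7: "smooth_on UNIV g7"
  unfolding g7_eq[abs_def]
  by (intro smooth_on_linear_compose[OF bounded_linear_Im] smooth_on_power smooth_on_Complex
      smooth_on_fst' smooth_on_snd' open_UNIV)

subsection \<open>Normal forms\<close>

lemma function_germI_smooth: "smooth_on UNIV f \<Longrightarrow> f 0 = 0 \<Longrightarrow> function_germ f"
  unfolding function_germ_def by (intro conjI exI[of _ UNIV]) auto

text \<open>With \<open>e = d - 1\<close>, three errors must have order \<open>d + 7\<close>. The
  quadratic error of \<open>g7\<close> has order \<open>7 + 2 * e\<close>, which suffices exactly
  when \<open>d \<ge> 2\<close>; the change of a form of degree \<open>m\<close> has order
  \<open>m + e\<close>, which suffices because \<open>m \<ge> 8\<close>; and \<open>R\<close> keeps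
  its order under composition. The sum over \<open>M\<close> carries all homogeneous terms at once,
  including the one that \<open>tangent\<close> then alters.\<close>

lemma R_equivalent_add_tangent:
  assumes "2 \<le> d" "finite M" "\<And>m. m \<in> M \<Longrightarrow> 8 \<le> m" "function_germ R" "vanishes (d + 7) R"
  shows "R_equivalent (d + 6) (\<lambda>p. g7 p + (\<Sum>m\<in>M. hpoly m (a m) p) + R p)
    (\<lambda>p. g7 p + (\<Sum>m\<in>M. hpoly m (a m) p) + tangent d u v p)"
proof -
  define \<tau> where "\<tau> = (\<lambda>p. (fst p + hpoly d u p, snd p + hpoly d v p))"
  let ?P = "\<lambda>p. \<Sum>m\<in>M. hpoly m (a m) p"
  obtain e where e: "Suc e = d" "1 \<le> e" using assms(1) by (cases d) auto
  have smP: "smooth_on UNIV ?P" by (intro smooth_on_sum smooth_on_hpoly open_UNIV)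
  have smT: "smooth_on UNIV (tangent d u v)"
    unfolding tangent_def[abs_def]
    by (intro smooth_on_mult smooth_on_const smooth_on_linear_compose[OF bounded_linear_Im] smooth_on_power
        smooth_on_Complex smooth_on_fst' smooth_on_snd' smooth_on_hpoly open_UNIV)
  have van: "vanishes (Suc e) (hpoly d u)" "vanishes (Suc e) (hpoly d v)"
    unfolding e by (rule vanishes_hpoly)+
  have smt: "smooth_on UNIV \<tau>"
    unfolding \<tau>_def by (intro smooth_on_Pair smooth_on_add smooth_on_fst' smooth_on_snd' smooth_on_hpoly open_UNIV)
  have diffeo: "diffeo_germ \<tau>"
    unfolding \<tau>_def
    by (intro diffeo_germ_near_identity smooth_on_hpoly vanishes_mono[OF assms(1) vanishes_hpoly])
  have smc: "smooth_on UNIV (\<lambda>p. f (\<tau> p))" if "smooth_on UNIV f" for f :: "real \<times> real \<Rightarrow> real"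
    by (rule smooth_on_compose[OF open_UNIV that smt]) simp
  obtain W where W: "open W" "0 \<in> W" "smooth_on W (\<lambda>p. R (\<tau> p))"
    using function_germ_compose[OF assms(4) diffeo] unfolding function_germ_def by blast
  let ?E1 = "\<lambda>p. g7 (\<tau> p) - g7 p - tangent d u v p"
  let ?E2 = "\<lambda>p. \<Sum>m\<in>M. hpoly m (a m) (\<tau> p) - hpoly m (a m) p"
  have sm1: "smooth_on UNIV ?E1" by (intro smooth_on_diff smc smooth_on_g7 smT open_UNIV)
  have smm: "smooth_on UNIV (\<lambda>p. hpoly m (a m) (\<tau> p) - hpoly m (a m) p)" for m
    by (intro smooth_on_diff smc smooth_on_hpoly open_UNIV)
  have sm2: "smooth_on UNIV ?E2" by (intro smooth_on_sum smm open_UNIV)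
  have "vanishes (7 + 2 * e) ?E1" unfolding \<tau>_def by (rule vanishes_g7_perturbed[OF e(1)])
  then have v1: "vanishes (d + 7) ?E1" by (rule vanishes_mono[rotated]) (use e in simp)
  have v2: "vanishes (d + 7) ?E2"
  proof (rule vanishes_sum[OF open_UNIV UNIV_I smm])
    fix m assume "m \<in> M"
    then have "d + 7 \<le> m + e" using assms(3)[of m] e by simp
    moreover have "vanishes (m + e) (\<lambda>p. hpoly m (a m) (\<tau> p) - hpoly m (a m) p)"
      unfolding \<tau>_def by (rule vanishes_hpoly_perturbed[OF smooth_on_hpoly smooth_on_hpoly van])
    ultimately show "vanishes (d + 7) (\<lambda>p. hpoly m (a m) (\<tau> p) - hpoly m (a m) p)"
      by (rule vanishes_mono)
  qed
  have v3: "vanishes (d + 7) (\<lambda>p. R (\<tau> p))" by (rule vanishes_compose_diffeo_germ[OF assms(4) diffeo assms(5)])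
  have v12: "vanishes (d + 7) (\<lambda>p. ?E1 p + ?E2 p)" by (rule vanishes_add[OF open_UNIV UNIV_I sm1 sm2 v1 v2])
  have "vanishes (d + 7) (\<lambda>p. ?E1 p + ?E2 p + R (\<tau> p))"
    by (rule vanishes_add[OF W(1,2) smooth_on_subset[OF smooth_on_add[OF open_UNIV sm1 sm2] subset_UNIV] W(3) v12 v3])
  then have E: "vanishes (Suc (d + 6)) (\<lambda>p. (g7 (\<tau> p) + ?P (\<tau> p) + R (\<tau> p)) - (g7 p + ?P p + tangent d u v p))"
    by (simp add: sum_subtractf algebra_simps)
  have "g7 0 + ?P 0 = 0"
  proof -
    have "hpoly m (a m) 0 = 0" if "m \<in> M" for m
      using vanishes_hpoly[of m "a m"] assms(3)[OF that] by (cases m) auto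
    then show ?thesis by (simp add: g7_eq flip: zero_complex.code)
  qed
  then have "function_germ (\<lambda>p. g7 p + ?P p + R p)"
    by (intro function_germ_add function_germI_smooth smooth_on_add smooth_on_g7 smP assms open_UNIV)
  then show ?thesis
    by (rule R_equivalentI[OF _ diffeo _ E]) (intro smooth_on_add smooth_on_g7 smP smT open_UNIV)
qed

lemma function_germ_zero: "function_germ (\<lambda>p. 0)"
  by (simp add: function_germI_smooth)

lemma degree_8_case:
  assumes "homogeneous_poly 8 \<rho>8"
  shows "\<exists>c1 c2 c3 :: real.
          (\<forall>p. partial_x (partial_x ((laplacian ^^ 3) \<rho>8)) p
                - 3 * partial_y (partial_y ((laplacian ^^ 3) \<rho>8)) p = c1) \<and>
          (\<forall>p. partial_x (partial_y ((laplacian ^^ 3) \<rho>8)) p = c2) \<and>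
          (\<forall>p. partial_y (partial_y ((laplacian ^^ 3) \<rho>8)) p = c3) \<and>
          R_equivalent 8
            (\<lambda>p. g7 p + \<rho>8 p)
            (\<lambda>(x, y). g7 (x, y) + c1 / fact 8 * x ^ 8 + c2 / (fact 7 * fact 1) * x ^ 7 * y
               + c3 / (fact 6 * fact 2) * x ^ 6 * y ^ 2)"
proof -
  obtain a where \<rho>8: "\<rho>8 = hpoly 8 a" using assms by (auto simp: homogeneous_poly_iff)
  define b where "b = laplacian_coeffs 2 (laplacian_coeffs 4 (laplacian_coeffs 6 a))"
  have b: "(laplacian ^^ 3) \<rho>8 = hpoly 2 b"
    using laplacian_hpoly[of 6] laplacian_hpoly[of 4] laplacian_hpoly[of 2]
    by (simp add: \<rho>8 b_def eval_nat_numeral)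
  have xx: "partial_x (partial_x (hpoly 2 b)) p = 2 * b 0"
    and xy: "partial_x (partial_y (hpoly 2 b)) p = b 1"
    and yy: "partial_y (partial_y (hpoly 2 b)) p = 2 * b 2" for p
    by (simp_all add: numeral_2_eq_2 partial_x_hpoly partial_y_hpoly hpoly_0)
  obtain u v where uv: "\<And>x y. hpoly 8 a (x, y) + tangent 2 u v (x, y)
    = ((35 * a 0 - 3 * a 4 - 10 * a 6 - 105 * a 8) / 35) * x ^ 8
      + ((7 * a 1 + 3 * a 3 + 3 * a 5 + 7 * a 7) / 7) * x ^ 7 * y
      + ((5 * a 2 + 6 * a 4 + 15 * a 6 + 140 * a 8) / 5) * x ^ 6 * y ^ 2"
    using normal_form_8[of a] by blast
  \<comment> \<open>Three rounds of \<open>laplacian_coeffs\<close> are evaluated. Both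
    \<open>b 0\<close> and \<open>b 2\<close> contain \<open>a 2\<close>; the factor 3 cancels it,
    in agreement with the solved coefficient of \<open>x ^ 8\<close>.\<close>
  have c: "(35 * a 0 - 3 * a 4 - 10 * a 6 - 105 * a 8) / 35 = (2 * b 0 - 3 * (2 * b 2)) / fact 8"
    "(7 * a 1 + 3 * a 3 + 3 * a 5 + 7 * a 7) / 7 = b 1 / (fact 7 * fact 1)"
    "(5 * a 2 + 6 * a 4 + 15 * a 6 + 140 * a 8) / 5 = 2 * b 2 / (fact 6 * fact 2)"
    by (simp_all add: b_def laplacian_coeffs_def fact_numeral numeral_eq_Suc field_simps)
  have "R_equivalent (2 + 6) (\<lambda>p. g7 p + (\<Sum>m\<in>{8}. hpoly m a p) + 0)
      (\<lambda>p. g7 p + (\<Sum>m\<in>{8}. hpoly m a p) + tangent 2 u v p)"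
    by (rule R_equivalent_add_tangent) (simp_all add: function_germ_zero vanishes_zero)
  moreover have "(\<lambda>p. g7 p + (\<Sum>m\<in>{8}. hpoly m a p) + tangent 2 u v p)
    = (\<lambda>(x, y). g7 (x, y) + (2 * b 0 - 3 * (2 * b 2)) / fact 8 * x ^ 8 + b 1 / (fact 7 * fact 1) * x ^ 7 * y
               + 2 * b 2 / (fact 6 * fact 2) * x ^ 6 * y ^ 2)"
    using uv unfolding c by (auto simp: fun_eq_iff add.assoc)
  ultimately have "R_equivalent 8 (\<lambda>p. g7 p + \<rho>8 p)
    (\<lambda>(x, y). g7 (x, y) + (2 * b 0 - 3 * (2 * b 2)) / fact 8 * x ^ 8 + b 1 / (fact 7 * fact 1) * x ^ 7 * y
               + 2 * b 2 / (fact 6 * fact 2) * x ^ 6 * y ^ 2)"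
    by (simp add: \<rho>8)
  then show ?thesis unfolding b xx xy yy by blast
qed

lemma degree_9_case:
  assumes "homogeneous_poly 8 \<rho>8" "homogeneous_poly 9 \<rho>9" "function_germ R10" "10 \<le> germ_order R10"
  shows "\<exists>c1 c2 :: real.
          (\<forall>p. partial_x ((laplacian ^^ 4) \<rho>9) p = c1) \<and>
          (\<forall>p. partial_y ((laplacian ^^ 4) \<rho>9) p = c2) \<and>
          R_equivalent 9
            (\<lambda>p. g7 p + \<rho>8 p + \<rho>9 p + R10 p)
            (\<lambda>(x, y). g7 (x, y) + \<rho>8 (x, y) + c1 / fact 9 * x ^ 9
               + c2 / (fact 8 * fact 1) * x ^ 8 * y)"
proof -
  obtain r where \<rho>8: "\<rho>8 = hpoly 8 r" using assms by (auto simp: homogeneous_poly_iff)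
  obtain a where \<rho>9: "\<rho>9 = hpoly 9 a" using assms by (auto simp: homogeneous_poly_iff)
  define b where "b = laplacian_coeffs 1 (laplacian_coeffs 3 (laplacian_coeffs 5 (laplacian_coeffs 7 a)))"
  have b: "(laplacian ^^ 4) \<rho>9 = hpoly 1 b"
    using laplacian_hpoly[of 7] laplacian_hpoly[of 5] laplacian_hpoly[of 3] laplacian_hpoly[of 1]
    by (simp add: \<rho>9 b_def eval_nat_numeral)
  have x: "partial_x (hpoly 1 b) p = b 0" and y: "partial_y (hpoly 1 b) p = b 1" for p
    by (simp_all add: partial_x_hpoly partial_y_hpoly hpoly_0)
  obtain u v where uv: "\<And>x y. hpoly 9 a (x, y) + tangent 3 u v (x, y)
    = ((63 * a 0 + 7 * a 2 + 3 * a 4 + 3 * a 6 + 7 * a 8) / 63) * x ^ 9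
      + ((7 * a 1 + 3 * a 3 + 3 * a 5 + 7 * a 7 + 63 * a 9) / 7) * x ^ 8 * y"
    using normal_form_9[of a] by blast
  have c: "(63 * a 0 + 7 * a 2 + 3 * a 4 + 3 * a 6 + 7 * a 8) / 63 = b 0 / fact 9"
    "(7 * a 1 + 3 * a 3 + 3 * a 5 + 7 * a 7 + 63 * a 9) / 7 = b 1 / (fact 8 * fact 1)"
    by (simp_all add: b_def laplacian_coeffs_def fact_numeral numeral_eq_Suc field_simps)
  \<comment> \<open>One coefficient sequence per degree, as the sum over \<open>M\<close> requires.
    Here \<open>d = 3\<close>, so \<open>R10\<close> has exactly the order \<open>d + 7\<close> that
    counts as negligible.\<close>
  let ?a = "\<lambda>m. if m = 8 then r else a"
  have "vanishes 10 R10"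
    using germ_order_ge_iff_vanishes[OF assms(3), of 10] assms(4) by (simp add: numeral_eq_enat)
  then have "R_equivalent (3 + 6) (\<lambda>p. g7 p + (\<Sum>m\<in>{8,9}. hpoly m (?a m) p) + R10 p)
      (\<lambda>p. g7 p + (\<Sum>m\<in>{8,9}. hpoly m (?a m) p) + tangent 3 u v p)"
    by (intro R_equivalent_add_tangent) (auto simp: assms(3))
  moreover have "(\<lambda>p. g7 p + (\<Sum>m\<in>{8,9}. hpoly m (?a m) p) + tangent 3 u v p)
    = (\<lambda>(x, y). g7 (x, y) + \<rho>8 (x, y) + b 0 / fact 9 * x ^ 9 + b 1 / (fact 8 * fact 1) * x ^ 8 * y)"
    using uv unfolding c by (auto simp: fun_eq_iff \<rho>8 add.assoc)
  ultimately have "R_equivalent 9 (\<lambda>p. g7 p + \<rho>8 p + \<rho>9 p + R10 p)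
    (\<lambda>(x, y). g7 (x, y) + \<rho>8 (x, y) + b 0 / fact 9 * x ^ 9 + b 1 / (fact 8 * fact 1) * x ^ 8 * y)"
    by (simp add: \<rho>8 \<rho>9 add.assoc)
  then show ?thesis unfolding b x y by blast
qed

lemma degree_10_case:
  assumes "homogeneous_poly 8 \<rho>8" "homogeneous_poly 9 \<rho>9" "homogeneous_poly 10 \<rho>10"
  shows "\<exists>c :: real.
          (\<forall>p. (laplacian ^^ 5) \<rho>10 p = c) \<and>
          R_equivalent 10
            (\<lambda>p. g7 p + \<rho>8 p + \<rho>9 p + \<rho>10 p)
            (\<lambda>(x, y). g7 (x, y) + \<rho>8 (x, y) + \<rho>9 (x, y) + c / fact 10 * x ^ 10)"
proof -
  obtain r where \<rho>8: "\<rho>8 = hpoly 8 r" using assms by (auto simp: homogeneous_poly_iff)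
  obtain s where \<rho>9: "\<rho>9 = hpoly 9 s" using assms by (auto simp: homogeneous_poly_iff)
  obtain a where \<rho>10: "\<rho>10 = hpoly 10 a" using assms by (auto simp: homogeneous_poly_iff)
  define b where "b = laplacian_coeffs 0 (laplacian_coeffs 2 (laplacian_coeffs 4
    (laplacian_coeffs 6 (laplacian_coeffs 8 a))))"
  have b: "(laplacian ^^ 5) \<rho>10 = hpoly 0 b"
    using laplacian_hpoly[of 8] laplacian_hpoly[of 6] laplacian_hpoly[of 4] laplacian_hpoly[of 2]
      laplacian_hpoly[of 0]
    by (simp add: \<rho>10 b_def eval_nat_numeral)
  obtain u v where uv: "\<And>x y. hpoly 10 a (x, y) + tangent 4 u v (x, y)
    = ((63 * a 0 + 7 * a 2 + 3 * a 4 + 3 * a 6 + 7 * a 8 + 63 * a 10) / 63) * x ^ 10"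
    using normal_form_10[of a] by blast
  have c: "(63 * a 0 + 7 * a 2 + 3 * a 4 + 3 * a 6 + 7 * a 8 + 63 * a 10) / 63 = b 0 / fact 10"
    by (simp add: b_def laplacian_coeffs_def fact_numeral numeral_eq_Suc field_simps)
  let ?a = "\<lambda>m. if m = 8 then r else if m = 9 then s else a"
  have "R_equivalent (4 + 6) (\<lambda>p. g7 p + (\<Sum>m\<in>{8,9,10}. hpoly m (?a m) p) + 0)
      (\<lambda>p. g7 p + (\<Sum>m\<in>{8,9,10}. hpoly m (?a m) p) + tangent 4 u v p)"
    by (intro R_equivalent_add_tangent) (auto simp: function_germ_zero vanishes_zero)
  moreover have "(\<lambda>p. g7 p + (\<Sum>m\<in>{8,9,10}. hpoly m (?a m) p) + tangent 4 u v p)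
    = (\<lambda>(x, y). g7 (x, y) + \<rho>8 (x, y) + \<rho>9 (x, y) + b 0 / fact 10 * x ^ 10)"
    using uv unfolding c by (auto simp: fun_eq_iff \<rho>8 \<rho>9 add.assoc)
  ultimately have "R_equivalent 10 (\<lambda>p. g7 p + \<rho>8 p + \<rho>9 p + \<rho>10 p)
    (\<lambda>(x, y). g7 (x, y) + \<rho>8 (x, y) + \<rho>9 (x, y) + b 0 / fact 10 * x ^ 10)"
    by (simp add: \<rho>8 \<rho>9 \<rho>10 add.assoc)
  then show ?thesis unfolding b hpoly_0 by blast
qed

section \<open>Harmonic forms of degree 7 and complex rescaling\<close>

lemma harmonic_degree_7:
  assumes "homogeneous_poly 7 h" "harmonic h"
  obtains c where "h = (\<lambda>p. Im (c * Complex (fst p) (snd p) ^ 7))"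
proof -
  obtain a where a: "h = hpoly 7 a" using assms by (auto simp: homogeneous_poly_iff)
  have "laplacian_coeffs 5 a i = 0" if "i \<le> 5" for i
  proof (rule hpoly_eq_0_imp[OF _ that])
    show "hpoly 5 (laplacian_coeffs 5 a) p = 0" for p
      using assms(2) laplacian_hpoly[of 5 a] by (simp add: harmonic_def a del: split_paired_All)
  qed
  \<comment> \<open>Harmonicity is a two-step recursion from \<open>a i\<close> to
    \<open>a (i + 2)\<close>, which leaves \<open>a 0\<close> and \<open>a 1\<close> free.\<close>
  from this[of 0] this[of 1] this[of 2] this[of 3] this[of 4] this[of 5]
  have rec: "a 2 = - 21 * a 0" "a 3 = - 5 * a 1" "a 4 = 35 * a 0" "a 5 = 3 * a 1"
    "a 6 = - 7 * a 0" "7 * a 7 = - a 1"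
    by (simp_all add: laplacian_coeffs_def numeral_eq_Suc)
  have a7: "a 7 = - a 1 / 7" using rec(6) by simp
  \<comment> \<open>The constant is read off two monomials: \<open>Re z^7\<close> begins with
    \<open>x^7\<close> and \<open>Im z^7\<close> with \<open>7 x^6 y\<close>, so the imaginary part
    is \<open>a 0\<close> and the real part is \<open>a 1 / 7\<close>.\<close>
  have "h (x, y) = Im (Complex (a 1 / 7) (a 0) * Complex x y ^ 7)" for x y
    unfolding a hpoly_def
    by (simp add: atMost_nat_numeral atMost_Suc rec(1-5)[simplified] a7[simplified] power_numeral_reduce algebra_simps)
  then have "h = (\<lambda>p. Im (Complex (a 1 / 7) (a 0) * Complex (fst p) (snd p) ^ 7))"
    by (auto simp: fun_eq_iff)
  then show ?thesis by (rule that)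
qed

definition complex_mult_plane :: "complex \<Rightarrow> real \<times> real \<Rightarrow> real \<times> real" where
  "complex_mult_plane \<zeta> p = (Re (\<zeta> * Complex (fst p) (snd p)), Im (\<zeta> * Complex (fst p) (snd p)))"

lemma linear_complex_mult_plane: "linear (complex_mult_plane \<zeta>)"
  by (rule linearI) (simp_all add: complex_mult_plane_def algebra_simps)

lemma norm_complex_mult_plane: "norm (complex_mult_plane \<zeta> p) = cmod \<zeta> * norm p"
proof -
  have "norm (Re z, Im z) = cmod z" for z
    by (simp add: norm_Pair cmod_def)
  moreover have "cmod (Complex (fst p) (snd p)) = norm p"
    by (cases p) (simp add: norm_Pair cmod_def)
  ultimately show ?thesis by (simp only: complex_mult_plane_def norm_mult)
qed

lemma complex_mult_plane_of_real_mult: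
  "complex_mult_plane (of_real r * \<zeta>) p = r *\<^sub>R complex_mult_plane \<zeta> p"
  by (simp add: complex_mult_plane_def algebra_simps)

text \<open>Polar decomposition: multiplication by \<open>sgn \<zeta>\<close> is linear and
  preserves the norm, hence orthogonal, and \<open>cmod \<zeta>\<close> is the scalar.\<close>

lemma linear_conformal_complex_mult_plane:
  assumes "\<zeta> \<noteq> 0"
  shows "linear_conformal (complex_mult_plane \<zeta>)"
proof -
  have "orthogonal_transformation (complex_mult_plane (sgn \<zeta>))"
    using assms
    by (simp add: orthogonal_transformation linear_complex_mult_plane norm_complex_mult_plane norm_sgn)
  moreover have "complex_mult_plane \<zeta> = (\<lambda>p. cmod \<zeta> *\<^sub>R complex_mult_plane (sgn \<zeta>) p)"
    using assms by (simp add: sgn_eq flip: complex_mult_plane_of_real_mult)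
  ultimately show ?thesis unfolding linear_conformal_def using assms by (metis norm_eq_zero)
qed

lemma diffeo_germ_complex_mult_plane:
  assumes "\<zeta> \<noteq> 0"
  shows "diffeo_germ (complex_mult_plane \<zeta>)"
proof (rule diffeo_germI[OF open_UNIV UNIV_I])
  have bl: "bounded_linear (complex_mult_plane \<zeta>)"
    using linear_complex_mult_plane linear_conv_bounded_linear by blast
  then show "smooth_on UNIV (complex_mult_plane \<zeta>)" by (rule smooth_on_bounded_linear)
  show "complex_mult_plane \<zeta> 0 = 0" by (rule linear_0[OF linear_complex_mult_plane])
  have "inj (complex_mult_plane \<zeta>)"
    unfolding linear_injective_0[OF linear_complex_mult_plane]
    using assms norm_complex_mult_plane by (metis mult_eq_0_iff norm_eq_zero)
  then show "inj (\<lambda>v. dir_deriv (complex_mult_plane \<zeta>) v 0)"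
    unfolding dir_deriv_eq[OF bounded_linear_imp_has_derivative[OF bl]] by simp
qed

lemma degree_7_case:
  assumes "homogeneous_poly 7 h7" "\<exists>p. h7 p \<noteq> 0" "harmonic h7" "function_germ R8" "8 \<le> germ_order R8"
  shows "\<exists>R8'. function_germ R8' \<and> germ_order R8' \<ge> 8 \<and>
          right_equivalent_linear_conformal (\<lambda>p. h7 p + R8 p) (\<lambda>p. g7 p + R8' p)"
proof -
  obtain c where c: "h7 = (\<lambda>p. Im (c * Complex (fst p) (snd p) ^ 7))"
    using harmonic_degree_7[OF assms(1,3)] .
  with assms(2) have "c \<noteq> 0" by auto
  \<comment> \<open>With this root, \<open>c * (\<zeta> * z) ^ 7 = z ^ 7\<close>, so multiplication
    by \<open>\<zeta>\<close> carries \<open>h7\<close> to \<open>g7\<close> exactly and only the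
    remainder changes.\<close>
  obtain \<zeta> where \<zeta>: "\<zeta> ^ 7 = inverse c"
    using exists_complex_root[of 7 "inverse c"] by (metis zero_neq_numeral)
  have "\<zeta> \<noteq> 0" using \<zeta> \<open>c \<noteq> 0\<close> by auto
  let ?\<tau> = "complex_mult_plane \<zeta>" and ?R = "\<lambda>p. R8 (complex_mult_plane \<zeta> p)"
  have diffeo: "diffeo_germ ?\<tau>" by (rule diffeo_germ_complex_mult_plane[OF \<open>\<zeta> \<noteq> 0\<close>])
  have germ: "function_germ ?R" by (rule function_germ_compose[OF assms(4) diffeo])
  have "enat 8 \<le> germ_order R8" using assms(5) by (simp add: numeral_eq_enat)
  then have "vanishes 8 ?R"
    using germ_order_ge_iff_vanishes[OF assms(4)] vanishes_compose_diffeo_germ[OF assms(4) diffeo] by blast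
  then have "enat 8 \<le> germ_order ?R" using germ_order_ge_iff_vanishes[OF germ] by blast
  moreover have "h7 (?\<tau> p) = g7 p" for p
  proof -
    have "Complex (fst (?\<tau> p)) (snd (?\<tau> p)) = \<zeta> * Complex (fst p) (snd p)"
      by (simp add: complex_mult_plane_def complex_eq_iff)
    moreover have "c * (\<zeta> * Complex (fst p) (snd p)) ^ 7 = Complex (fst p) (snd p) ^ 7"
      using \<open>c \<noteq> 0\<close> by (simp only: power_mult_distrib \<zeta>) simp
    ultimately show ?thesis by (simp only: c g7_eq)
  qed
  then have "right_equivalent_linear_conformal (\<lambda>p. h7 p + R8 p) (\<lambda>p. g7 p + ?R p)"
    unfolding right_equivalent_linear_conformal_def right_equivalent_by_def
    using linear_conformal_complex_mult_plane[OF \<open>\<zeta> \<noteq> 0\<close>] diffeo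
    by (intro exI[of _ ?\<tau>]) simp
  ultimately show ?thesis using germ by (auto simp: numeral_eq_enat)
qed

theorem theorem3:
  shows
   "(\<forall>h7 R8.
       homogeneous_poly 7 h7 \<and> (\<exists>p. h7 p \<noteq> 0) \<and> harmonic h7 \<and>
       function_germ R8 \<and> germ_order R8 \<ge> 8 \<longrightarrow>
       (\<exists>R8'. function_germ R8' \<and> germ_order R8' \<ge> 8 \<and>
          right_equivalent_linear_conformal (\<lambda>p. h7 p + R8 p) (\<lambda>p. g7 p + R8' p)))
    \<and>
    (\<forall>\<rho>8.
       homogeneous_poly 8 \<rho>8 \<longrightarrow>
       (\<exists>c1 c2 c3 :: real.
          (\<forall>p. partial_x (partial_x ((laplacian ^^ 3) \<rho>8)) p
                - 3 * partial_y (partial_y ((laplacian ^^ 3) \<rho>8)) p = c1) \<and>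
          (\<forall>p. partial_x (partial_y ((laplacian ^^ 3) \<rho>8)) p = c2) \<and>
          (\<forall>p. partial_y (partial_y ((laplacian ^^ 3) \<rho>8)) p = c3) \<and>
          R_equivalent 8
            (\<lambda>p. g7 p + \<rho>8 p)
            (\<lambda>(x, y). g7 (x, y) + c1 / fact 8 * x ^ 8 + c2 / (fact 7 * fact 1) * x ^ 7 * y
               + c3 / (fact 6 * fact 2) * x ^ 6 * y ^ 2)))
    \<and>
    (\<forall>\<rho>8 \<rho>9 R10.
       homogeneous_poly 8 \<rho>8 \<and> homogeneous_poly 9 \<rho>9 \<and>
       function_germ R10 \<and> germ_order R10 \<ge> 10 \<longrightarrow>
       (\<exists>c1 c2 :: real.
          (\<forall>p. partial_x ((laplacian ^^ 4) \<rho>9) p = c1) \<and>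
          (\<forall>p. partial_y ((laplacian ^^ 4) \<rho>9) p = c2) \<and>
          R_equivalent 9
            (\<lambda>p. g7 p + \<rho>8 p + \<rho>9 p + R10 p)
            (\<lambda>(x, y). g7 (x, y) + \<rho>8 (x, y) + c1 / fact 9 * x ^ 9
               + c2 / (fact 8 * fact 1) * x ^ 8 * y)))
    \<and>
    (\<forall>\<rho>8 \<rho>9 \<rho>10.
       homogeneous_poly 8 \<rho>8 \<and> homogeneous_poly 9 \<rho>9 \<and> homogeneous_poly 10 \<rho>10 \<longrightarrow>
       (\<exists>c :: real.
          (\<forall>p. (laplacian ^^ 5) \<rho>10 p = c) \<and>
          R_equivalent 10
            (\<lambda>p. g7 p + \<rho>8 p + \<rho>9 p + \<rho>10 p)
            (\<lambda>(x, y). g7 (x, y) + \<rho>8 (x, y) + \<rho>9 (x, y) + c / fact 10 * x ^ 10)))"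
  by (intro conjI allI impI; (elim conjE)?;
      (rule degree_7_case | rule degree_8_case | rule degree_9_case | rule degree_10_case); assumption)

end
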